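(* Let $T:E\to F$ be an order bounded operator between Banach lattices. The following are equivalent: (1) $T$ is an almost weak Dunford-Pettis operator. (2) For every relatively weakly compact $A\subset E$, $T(\mathrm{sol}(A))$ is an almost Dunford-Pettis set in $F$. (3) For every relatively weakly compact $A\subset E$, $T(A)$ is an almost Dunford-Pettis set in $F$. (4) For every relatively weakly compact $B\subset F'$, $T'(\mathrm{sol}(B))$ is an almost (L)-set in $E'$. (5) For every relatively weakly compact $B\subset F'$, $T'(B)$ is an almost (L)-set in $E'$.
   Context: $\mathrm{sol}(A)=\{x:|x|\le|a|\text{ for some }a\in A\}$ is the solid hull of $A$. A sequence is disjoint if $|x_n|\wedge|x_m|=0$ for $n\neq m$. $T$ is almost weak Dunford-Pettis if $f_n(Tx_n)\to0$ whenever $(x_n)\subset E$ and $(f_n)\subset F'$ are disjoint weakly null sequences. A norm bounded set $A\subset F$ is an almost Dunford-Pettis set if every disjoint weakly null sequence $(f_n)\subset F'$ satisfies $\sup_{y\in A}|f_n(y)|\to0$. A norm bounded set $B\subset E'$ is an almost (L)-set if every disjoint weakly null sequence $(x_n)\subset E$ satisfies $\sup_{g\in B}|g(x_n)|\to0$. $T'$ denotes the adjoint of $T$. *)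

theory Defs
  imports "HOL-Analysis.Analysis"
begin

definition lmod :: "'a::{ab_group_add, lattice} \<Rightarrow> 'a" where
  "lmod x = sup x (- x)"

class banach_lattice = banach + ordered_real_vector + lattice +
  assumes lattice_norm: "sup x (- x) \<le> sup y (- y) \<Longrightarrow> norm x \<le> norm y"

definition sol :: "'a::banach_lattice set \<Rightarrow> 'a set" where
  "sol A = {x. \<exists>a\<in>A. lmod x \<le> lmod a}"

definition disjoint_seq :: "(nat \<Rightarrow> 'a::banach_lattice) \<Rightarrow> bool" where
  "disjoint_seq x \<longleftrightarrow> (\<forall>n m. n \<noteq> m \<longrightarrow> inf (lmod (x n)) (lmod (x m)) = 0)"

section \<open>The dual Banach lattice E' (Riesz--Kantorovich formulas)\<close>

text \<open>Modulus of a functional, evaluated at a positive element x: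
  |f|(x) = sup { |f y| : |y| \<le> x }.\<close>
definition dmod :: "('a::banach_lattice \<Rightarrow>\<^sub>L real) \<Rightarrow> 'a \<Rightarrow> real" where
  "dmod f x = (SUP y\<in>{y. lmod y \<le> x}. \<bar>f y\<bar>)"

text \<open>Disjointness in E': (|f| inf |g|)(x) = inf { |f|(y) + |g|(x-y) : 0 \<le> y \<le> x } = 0
  for every x \<ge> 0.\<close>
definition dual_disjoint :: "('a::banach_lattice \<Rightarrow>\<^sub>L real) \<Rightarrow> ('a \<Rightarrow>\<^sub>L real) \<Rightarrow> bool" where
  "dual_disjoint f g \<longleftrightarrow>
     (\<forall>x. 0 \<le> x \<longrightarrow> (INF y\<in>{0..x}. dmod f y + dmod g (x - y)) = 0)"

definition dual_disjoint_seq :: "(nat \<Rightarrow> ('a::banach_lattice \<Rightarrow>\<^sub>L real)) \<Rightarrow> bool" where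
  "dual_disjoint_seq f \<longleftrightarrow> (\<forall>n m. n \<noteq> m \<longrightarrow> dual_disjoint (f n) (f m))"

text \<open>Solid hull of a set in E' (order of E': |g| \<le> |b| iff |g|(x) \<le> |b|(x) for all x \<ge> 0).\<close>
definition dual_sol :: "('a::banach_lattice \<Rightarrow>\<^sub>L real) set \<Rightarrow> ('a \<Rightarrow>\<^sub>L real) set" where
  "dual_sol B = {g. \<exists>b\<in>B. \<forall>x. 0 \<le> x \<longrightarrow> dmod g x \<le> dmod b x}"

definition weak_topology :: "'a::real_normed_vector topology" where
  "weak_topology = topology_generated_by
     {{x. blinfun_apply f x \<in> U} | (f :: 'a \<Rightarrow>\<^sub>L real) U. open U}"

definition weakly_null :: "(nat \<Rightarrow> 'a::real_normed_vector) \<Rightarrow> bool" where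
  "weakly_null x \<longleftrightarrow> (\<forall>f :: 'a \<Rightarrow>\<^sub>L real. (\<lambda>n. f (x n)) \<longlonglongrightarrow> 0)"

definition rel_weakly_compact :: "'a::real_normed_vector set \<Rightarrow> bool" where
  "rel_weakly_compact A \<longleftrightarrow> compactin weak_topology (weak_topology closure_of A)"

definition order_bounded :: "('a::banach_lattice \<Rightarrow>\<^sub>L 'b::banach_lattice) \<Rightarrow> bool" where
  "order_bounded T \<longleftrightarrow> (\<forall>a b. \<exists>c d. T ` {a..b} \<subseteq> {c..d})"

definition almost_weak_DP :: "('a::banach_lattice \<Rightarrow>\<^sub>L 'b::banach_lattice) \<Rightarrow> bool" where
  "almost_weak_DP T \<longleftrightarrow>
     (\<forall>(x :: nat \<Rightarrow> 'a) (f :: nat \<Rightarrow> ('b \<Rightarrow>\<^sub>L real)).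
        disjoint_seq x \<and> weakly_null x \<and> dual_disjoint_seq f \<and> weakly_null f
        \<longrightarrow> (\<lambda>n. f n (T (x n))) \<longlonglongrightarrow> 0)"

text \<open>sup over A of |f_n y| tends to 0, written as uniform convergence on A.\<close>
definition almost_DP_set :: "'b::banach_lattice set \<Rightarrow> bool" where
  "almost_DP_set A \<longleftrightarrow> bounded A \<and>
     (\<forall>f :: nat \<Rightarrow> ('b \<Rightarrow>\<^sub>L real). dual_disjoint_seq f \<and> weakly_null f \<longrightarrow>
        (\<forall>e>0. eventually (\<lambda>n. \<forall>y\<in>A. \<bar>f n y\<bar> \<le> e) sequentially))"

definition almost_L_set :: "('a::banach_lattice \<Rightarrow>\<^sub>L real) set \<Rightarrow> bool" where
  "almost_L_set B \<longleftrightarrow> bounded B \<and>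
     (\<forall>x :: nat \<Rightarrow> 'a. disjoint_seq x \<and> weakly_null x \<longrightarrow>
        (\<forall>e>0. eventually (\<lambda>n. \<forall>g\<in>B. \<bar>g (x n)\<bar> \<le> e) sequentially))"

definition adjoint_op :: "('a::real_normed_vector \<Rightarrow>\<^sub>L 'b::real_normed_vector)
     \<Rightarrow> ('b \<Rightarrow>\<^sub>L real) \<Rightarrow> ('a \<Rightarrow>\<^sub>L real)" where
  "adjoint_op T g = blinfun_compose g T"

end

theory Submission
  imports Defs "HOL-Library.Lattice_Algebras"
begin

text \<open>
  Everything rests on two facts. First, every disjoint sequence in the solid hull of a relatively
  weakly compact set \<open>W\<close> is weakly null: for \<open>f \<ge> 0\<close> the components of \<open>f\<close> carried by the
  terms of the sequence define an operator into \<open>\<ell>\<^sup>1\<close>, and the Schur property of \<open>\<ell>\<^sup>1\<close> makes it small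
  on \<open>W\<close>. Secondly, if positive functionals \<open>\<phi> n\<close> tend to 0 pointwise but not along a bounded
  positive sequence \<open>a\<close>, then they do not tend to 0 along some disjoint sequence dominated by a
  subsequence of \<open>a\<close>.

  Applied to \<open>\<phi> n = |T' f\<^sub>n|\<close> on \<open>E\<close>, respectively to evaluation at \<open>|T x\<^sub>n|\<close> on \<open>F'\<close>, this reduces uniform
  convergence on \<open>sol A\<close> and \<open>sol B\<close> to the defining property of an almost weak Dunford--Pettis
  operator. Order boundedness of \<open>T\<close> provides the pointwise convergence of \<open>\<phi> n\<close>; on \<open>F'\<close> through
  the positive functional \<open>|T'| g\<close>, which exists even when \<open>|T|\<close> does not.
\<close>

section \<open>Vector lattice calculus\<close>

text \<open>Both facts of the overview are needed in E as well as in F'. The dual is therefore made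
  a \<open>banach_lattice\<close> itself, so that each fact is proved once;
  \<open>dual_sol_eq_sol\<close> and \<open>dual_disjoint_seq_iff\<close> identify the explicit
  Riesz-Kantorovich formulas of the definitions with the lattice notions of that instance. Used in
  F', the facts involve functionals on F', and the bidual is again a dual of a
  \<open>banach_lattice\<close>.

  One obstacle recurs: a relatively weakly compact set W need not be solid, and the moduli of its
  elements need not form a relatively weakly compact set. Domination in the solid hull only gives
  estimates at \<open>lmod y\<close> with \<open>y\<close> in W, while compactness controls
  \<open>y\<close> itself. \<open>dual_attains_half_lmod\<close> goes from one to the other by
  replacing a positive functional with a smaller one, at the price of a factor 2. The same lemma
  removes the modulus of \<open>T x\<close> when the roles of vectors and functionals are
  exchanged.\<close>

instance banach_lattice \<subseteq> lattice_ab_group_add ..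

lemma lmod_le_iff: "lmod x \<le> y \<longleftrightarrow> x \<le> y \<and> - x \<le> (y::'a::banach_lattice)"
  by (simp add: lmod_def)

lemma lmod_ge: "x \<le> lmod x" "- x \<le> lmod (x::'a::banach_lattice)"
  by (simp_all add: lmod_def)

lemma lmod_nonneg [simp]: "0 \<le> lmod (x::'a::banach_lattice)"
proof -
  have "x + - x \<le> lmod x + lmod x" by (intro add_mono lmod_ge)
  then show ?thesis by simp
qed

lemma lmod_minus [simp]: "lmod (- x) = lmod (x::'a::banach_lattice)"
  by (simp add: lmod_def sup_commute)

lemma lmod_of_nonneg [simp]: "0 \<le> x \<Longrightarrow> lmod x = (x::'a::banach_lattice)"
  unfolding lmod_def by (rule sup_absorb1) (simp add: minus_le_self_iff)

lemma lmod_triangle: "lmod (x + y) \<le> lmod x + lmod (y::'a::banach_lattice)"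
  unfolding lmod_le_iff minus_add_distrib by (intro conjI add_mono lmod_ge)

lemma lmod_le_norm: "lmod x \<le> lmod y \<Longrightarrow> norm x \<le> norm (y::'a::banach_lattice)"
  using lattice_norm by (simp add: lmod_def)

lemma norm_lmod [simp]: "norm (lmod x) = norm (x::'a::banach_lattice)"
  by (intro antisym lmod_le_norm) simp_all

lemma norm_mono: "0 \<le> x \<Longrightarrow> x \<le> y \<Longrightarrow> norm x \<le> norm (y::'a::banach_lattice)"
  using lmod_le_norm[of x y] order_trans[of 0 x y] by simp

lemma pprt_minus_pprt: "x = pprt x - pprt (- (x::'a::banach_lattice))"
  by (metis add.inverse_inverse diff_minus_eq_add minus_diff_eq pprt_neg prts uminus_add_conv_diff)

text \<open>Both |x| + x and twice the positive part equal sup (2x) 0; subtracting x leaves the sum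
  of the two parts.\<close>

lemma lmod_eq_pprt: "lmod x = pprt x + pprt (- (x::'a::banach_lattice))"
proof -
  have "lmod x + x = sup (x + x) 0"
    by (simp add: lmod_def add_sup_distrib_right)
  moreover have "pprt x + pprt x = sup (x + x) 0"
  proof (rule antisym)
    have "pprt x + pprt x = sup (sup (x + x) x) (sup x 0)"
      by (simp add: pprt_def add_sup_distrib_left add_sup_distrib_right sup_assoc)
    moreover have "x \<le> sup (x + x) 0"
    proof -
      \<comment> \<open>An inequality is halved here: a group element whose double is nonnegative is
        itself nonnegative in a lattice-ordered group.\<close>
      have "0 \<le> sup (x + x) 0 - x + (sup (x + x) 0 - x)"
      proof -
        have "x + x \<le> sup (x + x) 0 + sup (x + x) 0"
          by (metis add.right_neutral add_mono sup.cobounded1 sup.cobounded2)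
        then show ?thesis by (simp add: algebra_simps)
      qed
      then show ?thesis by simp
    qed
    ultimately show "pprt x + pprt x \<le> sup (x + x) 0" by simp
    show "sup (x + x) 0 \<le> pprt x + pprt x"
      by (simp add: pprt_def add_mono)
  qed
  ultimately have "lmod x + x = pprt x + pprt x" by simp
  then have "lmod x = pprt x + (pprt x - x)" by (metis add_diff_cancel add_diff_eq)
  also have "pprt x - x = pprt (- x)" using pprt_minus_pprt[of x] by (metis diff_diff_eq2 add_diff_cancel_left')
  finally show ?thesis .
qed

lemma pprt_disjoint: "inf (pprt x) (pprt (- (x::'a::banach_lattice))) = 0"
proof -
  have "inf (pprt x) (pprt (- x)) = inf (x + pprt (- x)) (0 + pprt (- x))"
    using pprt_minus_pprt[of x] by (metis add.left_neutral diff_add_cancel)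
  also have "\<dots> = inf x 0 + pprt (- x)" by (simp add: add_inf_distrib_right)
  also have "\<dots> = 0" by (simp only: pprt_neg nprt_def add.right_inverse)
  finally show ?thesis .
qed

lemma pprt_le_lmod: "pprt x \<le> lmod (x::'a::banach_lattice)"
  by (simp add: pprt_def lmod_ge)

lemma scaleR_sup:
  fixes x y :: "'a::banach_lattice"
  assumes "0 \<le> r" shows "r *\<^sub>R sup x y = sup (r *\<^sub>R x) (r *\<^sub>R y)"
proof (cases "r = 0")
  case False
  with assms have r: "0 < r" by simp
  show ?thesis
  proof (rule antisym)
    have "sup x y \<le> (1 / r) *\<^sub>R sup (r *\<^sub>R x) (r *\<^sub>R y)"
      using r scaleR_left_mono[of "r *\<^sub>R x" "sup (r *\<^sub>R x) (r *\<^sub>R y)" "1 / r"]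
        scaleR_left_mono[of "r *\<^sub>R y" "sup (r *\<^sub>R x) (r *\<^sub>R y)" "1 / r"] by simp
    from scaleR_left_mono[OF this, of r] r show "r *\<^sub>R sup x y \<le> sup (r *\<^sub>R x) (r *\<^sub>R y)" by simp
  qed (simp add: scaleR_left_mono assms)
qed simp

lemma scaleR_inf:
  fixes x y :: "'a::banach_lattice"
  assumes "0 \<le> r" shows "r *\<^sub>R inf x y = inf (r *\<^sub>R x) (r *\<^sub>R y)"
  using scaleR_sup[OF assms, of "- x" "- y"] by (simp only: inf_eq_neg_sup scaleR_minus_right)

lemma lmod_scaleR: "lmod (r *\<^sub>R x) = \<bar>r\<bar> *\<^sub>R lmod (x::'a::banach_lattice)"
proof -
  have *: "lmod (s *\<^sub>R x) = s *\<^sub>R lmod x" if "0 \<le> s" for s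
    using scaleR_sup[OF that, of x "- x"] by (simp add: lmod_def)
  show ?thesis
    using *[of r] *[of "- r"] by (cases "0 \<le> r") simp_all
qed

text \<open>The right side expands to the infimum of \<open>x + y\<close>, \<open>x + u\<close>,
  \<open>u + y\<close> and \<open>u + u\<close>, and the last three lie above
  \<open>u\<close>.\<close>

lemma inf_add_le:
  fixes x y u :: "'a::banach_lattice"
  assumes "0 \<le> x" "0 \<le> y" "0 \<le> u"
  shows "inf (x + y) u \<le> inf x u + inf y u"
proof -
  have "inf x u + inf y u = inf (inf (x + y) (x + u)) (inf (u + y) (u + u))"
    by (simp add: add_inf_distrib_left add_inf_distrib_right inf_assoc inf.left_commute inf_commute)
  moreover have "u \<le> x + u" "u \<le> u + y" "u \<le> u + u" using assms by simp_all
  ultimately show ?thesis by (auto intro: le_infI2)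
qed

section \<open>Disjoint elements and Riesz decomposition\<close>

lemma disjoint_scaleR:
  fixes a b :: "'a::banach_lattice"
  assumes "inf a b = 0" "0 \<le> r" shows "inf a (r *\<^sub>R b) = 0"
proof -
  have pos: "0 \<le> a" "0 \<le> b" using assms(1) by (metis inf.cobounded1, metis inf.cobounded2)
  \<comment> \<open>A common factor that is at least 1 and at least \<open>r\<close> dominates both
    arguments, so it can be pulled out of the infimum.\<close>
  define c where "c = max 1 r"
  have "r *\<^sub>R b \<le> c *\<^sub>R b" unfolding c_def using pos by (intro scaleR_right_mono) auto
  moreover have "a \<le> c *\<^sub>R a"
    using scaleR_right_mono[of 1 c a] pos by (simp add: c_def)
  ultimately have "inf a (r *\<^sub>R b) \<le> inf (c *\<^sub>R a) (c *\<^sub>R b)" by (rule inf_mono[rotated])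
  also have "\<dots> = c *\<^sub>R inf a b" by (rule scaleR_inf[symmetric]) (simp add: c_def)
  finally have "inf a (r *\<^sub>R b) \<le> 0" using assms by simp
  moreover have "0 \<le> inf a (r *\<^sub>R b)" using pos assms by (simp add: scaleR_nonneg_nonneg)
  ultimately show ?thesis by simp
qed

lemma disjoint_mono:
  fixes a b :: "'a::banach_lattice"
  assumes "inf a b = 0" "0 \<le> x" "x \<le> a" "0 \<le> y" "y \<le> b" shows "inf x y = 0"
proof (rule antisym)
  show "inf x y \<le> 0" using inf_mono[OF assms(3,5)] assms(1) by simp
qed (use assms in simp)

lemma disjoint_add:
  fixes a b c :: "'a::banach_lattice"
  assumes "inf a c = 0" "inf b c = 0" shows "inf (a + b) c = 0"
proof -
  have pos: "0 \<le> a" "0 \<le> b" "0 \<le> c" using assms by (metis inf.cobounded1 inf.cobounded2)+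
  then have "inf (a + b) c \<le> inf a c + inf b c" by (intro inf_add_le)
  moreover have "0 \<le> inf (a + b) c" using pos by simp
  ultimately show ?thesis using assms by simp
qed

lemma disjoint_sum:
  fixes a :: "'i \<Rightarrow> 'a::banach_lattice"
  assumes "finite I" "0 \<le> c" "\<And>i. i \<in> I \<Longrightarrow> inf (a i) c = 0"
  shows "inf (sum a I) c = 0"
  using assms by (induction I rule: finite_induct) (auto simp: inf_absorb1 intro: disjoint_add)

text \<open>For disjoint elements the sum is the supremum, because a + b = inf a b + sup a
  b.\<close>

lemma sum_disjoint_le:
  fixes a :: "'i \<Rightarrow> 'a::banach_lattice"
  assumes "finite I" "\<And>i. i \<in> I \<Longrightarrow> 0 \<le> a i" "\<And>i. i \<in> I \<Longrightarrow> a i \<le> z" "0 \<le> z"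
    "\<And>i j. i \<in> I \<Longrightarrow> j \<in> I \<Longrightarrow> i \<noteq> j \<Longrightarrow> inf (a i) (a j) = 0"
  shows "sum a I \<le> z"
  using assms
proof (induction I rule: finite_induct)
  case (insert i I)
  have "inf (sum a I) (a i) = 0"
    by (rule disjoint_sum) (use insert in auto)
  then have "sum a I + a i = sup (sum a I) (a i)"
    using add_eq_inf_sup[of "sum a I" "a i"] by simp
  moreover have "sum a I \<le> z" using insert by auto
  ultimately show ?case using insert by (simp add: add.commute)
qed simp

lemma riesz_decomposition_lmod:
  fixes y a b :: "'a::banach_lattice"
  assumes "lmod y \<le> a + b" "0 \<le> a" "0 \<le> b"
  obtains u v where "y = u + v" "lmod u \<le> a" "lmod v \<le> b"
proof
  \<comment> \<open>\<open>u\<close> is \<open>y\<close> truncated to the interval from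
    \<open>- a\<close> to \<open>a\<close>. The remainder has modulus at most \<open>b\<close>
    because \<open>y - b \<le> u \<le> y + b\<close>.\<close>
  define u where "u = inf (sup y (- a)) a"
  show "y = u + (y - u)" by simp
  have y: "y \<le> a + b" "- y \<le> a + b" using assms by (auto simp: lmod_le_iff)
  have a: "- a \<le> a" using assms by (simp add: minus_le_self_iff)
  show "lmod u \<le> a" unfolding lmod_le_iff u_def
    using a by (simp add: neg_inf_eq_sup neg_sup_eq_inf)
  have "y - b \<le> y" using assms by simp
  then have "y - b \<le> u" unfolding u_def
    using y assms by (simp add: algebra_simps add_increasing)
  moreover have "u \<le> y + b"
  proof -
    have "- a \<le> y + b" using add_mono[OF y(2) order_refl[of "y - a"]] by (simp add: algebra_simps)
    then have "sup y (- a) \<le> y + b" using assms by simp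
    then show ?thesis unfolding u_def by (simp add: le_infI1)
  qed
  ultimately show "lmod (y - u) \<le> b" unfolding lmod_le_iff by (simp add: algebra_simps)
qed

text \<open>The negative part of the limit \<open>x\<close> is at most the positive part of
  \<open>X n - x\<close>, so its norm is bounded by a null sequence.\<close>

lemma nonneg_limit:
  fixes X :: "nat \<Rightarrow> 'a::banach_lattice"
  assumes "X \<longlonglongrightarrow> x" "\<And>n. 0 \<le> X n" shows "0 \<le> x"
proof -
  have "norm (pprt (- x)) \<le> norm (X n - x)" for n
  proof -
    have "pprt (- x) \<le> pprt (X n - x)"
      using assms(2)[of n] by (intro pprt_mono) simp
    also have "\<dots> \<le> lmod (X n - x)" by (rule pprt_le_lmod)
    finally show ?thesis by (metis norm_lmod norm_mono zero_le_pprt)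
  qed
  moreover have "(\<lambda>n. norm (X n - x)) \<longlonglongrightarrow> 0"
    using assms(1) by (simp add: LIM_zero_iff tendsto_norm_zero_iff)
  ultimately have "norm (pprt (- x)) \<le> 0" by (intro LIMSEQ_le_const) auto
  then show ?thesis by (simp add: le_zero_iff_zero_pprt[symmetric])
qed

lemma summand_le_suminf:
  fixes X :: "nat \<Rightarrow> 'a::banach_lattice"
  assumes "summable X" "\<And>n. 0 \<le> X n" shows "X n \<le> suminf X"
proof -
  have "(\<lambda>k. sum X {..<k + Suc n} - X n) \<longlonglongrightarrow> suminf X - X n"
    by (intro tendsto_diff tendsto_const LIMSEQ_ignore_initial_segment summable_LIMSEQ assms)
  moreover have "0 \<le> sum X {..<k + Suc n} - X n" for k
    using sum_mono2[of "{..<k + Suc n}" "{n}" X] assms(2) by simp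
  ultimately have "0 \<le> suminf X - X n" by (rule nonneg_limit)
  then show ?thesis by simp
qed

section \<open>The dual Banach lattice\<close>

text \<open>Automatic continuity of positive functionals. Unit vectors \<open>y n\<close> with
  \<open>p (y n) > 4 ^ n\<close>, summed with weights \<open>1 / 2 ^ n\<close>, give by completeness
  an element on which \<open>p\<close> exceeds every \<open>2 ^ n\<close>.\<close>

lemma positive_cone_bounded:
  fixes p :: "'a::banach_lattice \<Rightarrow> real"
  assumes add: "\<And>x y. 0 \<le> x \<Longrightarrow> 0 \<le> y \<Longrightarrow> p (x + y) = p x + p y"
    and scale: "\<And>r x. 0 < r \<Longrightarrow> 0 \<le> x \<Longrightarrow> p (r *\<^sub>R x) = r * p x"
    and pos: "\<And>x. 0 \<le> x \<Longrightarrow> 0 \<le> p x"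
  obtains C where "\<And>x. 0 \<le> x \<Longrightarrow> p x \<le> C * norm x"
proof (rule ccontr)
  assume "\<not> thesis"
  with that have "\<exists>x\<ge>0. p x > 4 ^ n * norm x" for n :: nat by (meson not_le)
  then obtain x where x: "\<And>n. 0 \<le> x n" "\<And>n. p (x n) > 4 ^ n * norm (x n)" by metis
  have p0: "p 0 = 0" using add[of 0 0] by simp
  have nx: "norm (x n) > 0" for n using x(2)[of n] p0 by auto
  define y where "y n = (1 / norm (x n)) *\<^sub>R x n" for n
  have y: "0 \<le> y n" "norm (y n) = 1" "p (y n) > 4 ^ n" for n
    using nx[of n] x[of n] by (simp_all add: y_def scaleR_nonneg_nonneg scale pos_less_divide_eq)
  define X where "X n = (1 / 2 ^ n) *\<^sub>R y n" for n
  have "summable (\<lambda>n. norm (X n))"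
    using summable_geometric[of "1 / 2 :: real"] by (simp add: X_def y power_one_over)
  then have sm: "summable X" by (rule summable_norm_cancel)
  have X0: "0 \<le> X n" for n by (simp add: X_def y scaleR_nonneg_nonneg)
  have "2 ^ n \<le> p (suminf X)" for n
  proof -
    have "X n \<le> suminf X" by (rule summand_le_suminf[OF sm X0])
    then have "p (X n) \<le> p (suminf X)"
      using add[of "X n" "suminf X - X n"] pos[of "suminf X - X n"] X0 by simp
    moreover have "p (X n) = p (y n) / 2 ^ n" unfolding X_def using y by (simp add: scale)
    moreover have "4 ^ n / 2 ^ n \<le> p (y n) / 2 ^ n" using y(3)[of n] by (simp add: divide_right_mono)
    moreover have "(4::real) ^ n / 2 ^ n = 2 ^ n" by (simp add: power_divide[symmetric])
    ultimately show ?thesis by simp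
  qed
  then show False using real_arch_pow[of 2 "p (suminf X)"] by (smt (verit))
qed

text \<open>Kantorovich extension. It produces the modulus of a functional, its band components and
  the modulus of the adjoint, each given by a supremum that is additive only on the cone.\<close>

lemma positive_cone_extension:
  fixes p :: "'a::banach_lattice \<Rightarrow> real"
  assumes add: "\<And>x y. 0 \<le> x \<Longrightarrow> 0 \<le> y \<Longrightarrow> p (x + y) = p x + p y"
    and scale: "\<And>r x. 0 < r \<Longrightarrow> 0 \<le> x \<Longrightarrow> p (r *\<^sub>R x) = r * p x"
    and pos: "\<And>x. 0 \<le> x \<Longrightarrow> 0 \<le> p x"
  obtains F :: "'a \<Rightarrow>\<^sub>L real" where "\<And>x. 0 \<le> x \<Longrightarrow> F x = p x"
proof -
  obtain C where C: "\<And>x. 0 \<le> x \<Longrightarrow> p x \<le> C * norm x"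
    using positive_cone_bounded[of p] assms by blast
  have p0: "p 0 = 0" using add[of 0 0] by simp
  define F where "F x = p (pprt x) - p (pprt (- x))" for x
  \<comment> \<open>The value is independent of the chosen splitting into positive elements.
    Linearity then follows by choosing the splitting that fits: sums of parts for addition,
    exchanged parts for a negative scalar.\<close>
  have F: "F (a - b) = p a - p b" if "0 \<le> a" "0 \<le> b" for a b
  proof -
    have "pprt (a - b) + b = a + pprt (- (a - b))"
    proof -
      have "p + b = a + q" if "p - q = a - b" for p q using that by (simp add: algebra_simps)
      from this[OF pprt_minus_pprt[of "a - b", symmetric]] show ?thesis .
    qed
    then have "p (pprt (a - b)) + p b = p a + p (pprt (- (a - b)))"
      using add[OF zero_le_pprt, of b] add[OF _ zero_le_pprt, of a] that by metis
    then show ?thesis unfolding F_def by simp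
  qed
  have "bounded_linear F"
  proof (rule bounded_linear_intro[where K = "2 * \<bar>C\<bar>"])
    fix x y :: 'a and r :: real
    have "x + y = (pprt x + pprt y) - (pprt (- x) + pprt (- y))"
      by (simp only: add_diff_add pprt_minus_pprt[symmetric])
    then have "F (x + y) = p (pprt x + pprt y) - p (pprt (- x) + pprt (- y))"
      using F[of "pprt x + pprt y" "pprt (- x) + pprt (- y)"] by (simp add: add_nonneg_nonneg)
    then show "F (x + y) = F x + F y" by (simp add: add F_def)
    show "F (r *\<^sub>R x) = r *\<^sub>R F x"
    proof -
      consider "r = 0" | "0 < r" | "r < 0" by linarith
      then show ?thesis
      proof cases
        case 1 then show ?thesis by (simp add: F_def)
      next
        case 2
        have "r *\<^sub>R x = r *\<^sub>R pprt x - r *\<^sub>R pprt (- x)"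
          by (simp only: pprt_minus_pprt[symmetric] scaleR_diff_right[symmetric])
        then have "F (r *\<^sub>R x) = p (r *\<^sub>R pprt x) - p (r *\<^sub>R pprt (- x))"
          using 2 F[of "r *\<^sub>R pprt x" "r *\<^sub>R pprt (- x)"] by (simp add: scaleR_nonneg_nonneg)
        then show ?thesis using 2 by (simp add: scale F_def right_diff_distrib)
      next
        case 3
        have "r *\<^sub>R x = r *\<^sub>R pprt x - r *\<^sub>R pprt (- x)"
          by (simp only: pprt_minus_pprt[symmetric] scaleR_diff_right[symmetric])
        then have "r *\<^sub>R x = (- r) *\<^sub>R pprt (- x) - (- r) *\<^sub>R pprt x"
          by simp
        moreover have "F ((- r) *\<^sub>R pprt (- x) - (- r) *\<^sub>R pprt x) = p ((- r) *\<^sub>R pprt (- x)) - p ((- r) *\<^sub>R pprt x)"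
          using 3 by (intro F scaleR_nonneg_nonneg) auto
        moreover have "p ((- r) *\<^sub>R pprt (- x)) = (- r) * p (pprt (- x))" "p ((- r) *\<^sub>R pprt x) = (- r) * p (pprt x)"
          using 3 by (intro scale; simp)+
        ultimately show ?thesis by (simp add: F_def right_diff_distrib)
      qed
    qed
    have b: "p (pprt z) \<le> \<bar>C\<bar> * norm z" for z :: 'a
    proof -
      have "p (pprt z) \<le> \<bar>C\<bar> * norm (pprt z)"
        using C[of "pprt z"] by (smt (verit) mult_right_mono norm_ge_zero zero_le_pprt)
      also have "\<dots> \<le> \<bar>C\<bar> * norm z"
        using norm_mono[OF zero_le_pprt pprt_le_lmod, of z] by (simp add: mult_left_mono)
      finally show ?thesis .
    qed
    have "norm (F x) \<le> p (pprt x) + p (pprt (- x))"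
      using pos[of "pprt x"] pos[of "pprt (- x)"] by (simp add: F_def)
    also have "\<dots> \<le> norm x * (2 * \<bar>C\<bar>)" using b[of x] b[of "- x"] by (simp add: algebra_simps)
    finally show "norm (F x) \<le> norm x * (2 * \<bar>C\<bar>)" .
  qed
  then have "blinfun_apply (Blinfun F) x = p x" if "0 \<le> x" for x
    using F[of x 0] that p0 by (simp add: bounded_linear_Blinfun_apply)
  then show thesis by (rule that)
qed

section \<open>The Riesz-Kantorovich modulus of a functional\<close>

lemma dmod_upper:
  assumes "lmod y \<le> x" shows "\<bar>blinfun_apply f y\<bar> \<le> dmod f x"
  unfolding dmod_def
proof (rule cSUP_upper)
  show "bdd_above ((\<lambda>y. \<bar>blinfun_apply f y\<bar>) ` {y. lmod y \<le> x})"
  proof (rule bdd_aboveI2)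
    fix z assume "z \<in> {y. lmod y \<le> x}"
    then have "norm z \<le> norm x" using norm_mono[of "lmod z" x] by simp
    then have "norm f * norm z \<le> norm f * norm x" by (rule mult_left_mono) simp
    then show "\<bar>blinfun_apply f z\<bar> \<le> norm f * norm x"
      using norm_blinfun[of f z] by simp
  qed
qed (use assms in simp)

lemma dmod_least:
  assumes "0 \<le> x" "\<And>y. lmod y \<le> x \<Longrightarrow> \<bar>blinfun_apply f y\<bar> \<le> c" shows "dmod f x \<le> c"
  unfolding dmod_def
proof (rule cSUP_least)
  show "{y. lmod y \<le> x} \<noteq> {}" using assms(1) by (auto intro!: exI[of _ x])
qed (use assms in simp)

lemma dmod_approx:
  assumes "0 \<le> x" "c < dmod f x"
  obtains y where "lmod y \<le> x" "c < \<bar>blinfun_apply f y\<bar>"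
proof (rule ccontr)
  assume "\<not> thesis"
  with that have "\<bar>blinfun_apply f y\<bar> \<le> c" if "lmod y \<le> x" for y
    using \<open>lmod y \<le> x\<close> not_le by blast
  from dmod_least[OF assms(1) this] assms(2) show False by simp
qed

lemma dmod_nonneg: "0 \<le> x \<Longrightarrow> 0 \<le> dmod f x"
  using dmod_upper[of 0 x f] by simp

lemma dmod_add:
  assumes "0 \<le> x" "0 \<le> y" shows "dmod f (x + y) = dmod f x + dmod f y"
proof (rule antisym)
  show "dmod f (x + y) \<le> dmod f x + dmod f y"
  proof (rule dmod_least)
    fix z assume "lmod z \<le> x + y"
    then obtain u v where "z = u + v" "lmod u \<le> x" "lmod v \<le> y"
      using riesz_decomposition_lmod assms by blast
    then show "\<bar>blinfun_apply f z\<bar> \<le> dmod f x + dmod f y"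
      using dmod_upper[of u x f] dmod_upper[of v y f] by (simp add: blinfun.add_right)
  qed (use assms in simp)
  \<comment> \<open>For real numbers |s| + |t| is the larger of |s + t| and |s - t|, and both
    \<open>u + v\<close> and \<open>u - v\<close> are admissible for \<open>x + y\<close>.\<close>
  have *: "\<bar>blinfun_apply f u\<bar> + \<bar>blinfun_apply f v\<bar> \<le> dmod f (x + y)" if "lmod u \<le> x" "lmod v \<le> y" for u v
  proof -
    have "lmod (u + v) \<le> x + y" "lmod (u - v) \<le> x + y"
      using order_trans[OF lmod_triangle[of u v] add_mono[OF that]]
        order_trans[OF lmod_triangle[of u "- v"]] add_mono[OF that] by simp_all
    then have "\<bar>blinfun_apply f (u + v)\<bar> \<le> dmod f (x + y)" "\<bar>blinfun_apply f (u - v)\<bar> \<le> dmod f (x + y)"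
      by (simp_all add: dmod_upper)
    then show ?thesis by (simp add: blinfun.add_right blinfun.diff_right)
  qed
  have "dmod f x \<le> dmod f (x + y) - dmod f y"
  proof (rule dmod_least)
    fix u assume u: "lmod u \<le> x"
    have "dmod f y \<le> dmod f (x + y) - \<bar>blinfun_apply f u\<bar>"
      by (rule dmod_least) (use *[OF u] assms in \<open>auto simp: le_diff_eq add.commute\<close>)
    then show "\<bar>blinfun_apply f u\<bar> \<le> dmod f (x + y) - dmod f y" by simp
  qed (use assms in simp)
  then show "dmod f x + dmod f y \<le> dmod f (x + y)" by simp
qed

lemma dmod_scaleR:
  assumes "0 < r" "0 \<le> x" shows "dmod f (r *\<^sub>R x) = r * dmod f x"
proof -
  have *: "dmod f (s *\<^sub>R z) \<le> s * dmod f z" if "0 < s" "0 \<le> z" for s z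
  proof (rule dmod_least)
    fix y assume y: "lmod y \<le> s *\<^sub>R z"
    have "lmod ((1 / s) *\<^sub>R y) \<le> z"
      using scaleR_left_mono[OF y, of "1 / s"] that by (simp add: lmod_scaleR)
    from dmod_upper[OF this, of f] that show "\<bar>blinfun_apply f y\<bar> \<le> s * dmod f z"
      by (simp add: blinfun.scaleR_right abs_mult field_simps)
  qed (use that in \<open>simp add: scaleR_nonneg_nonneg\<close>)
  have "dmod f x \<le> (1 / r) * dmod f (r *\<^sub>R x)"
    using *[of "1 / r" "r *\<^sub>R x"] assms by (simp add: scaleR_nonneg_nonneg)
  then show ?thesis using *[of r x] assms by (simp add: field_simps)
qed

text \<open>Prescribing the values on the cone determines the functional, since every vector is a
  difference of positive ones.\<close>

definition dual_abs :: "('a::banach_lattice \<Rightarrow>\<^sub>L real) \<Rightarrow> 'a \<Rightarrow>\<^sub>L real" where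
  "dual_abs f = (SOME g. \<forall>x\<ge>0. blinfun_apply g x = dmod f x)"

lemma dual_abs_apply: "0 \<le> x \<Longrightarrow> blinfun_apply (dual_abs f) x = dmod f x"
proof -
  have "\<exists>g :: 'a \<Rightarrow>\<^sub>L real. \<forall>x\<ge>0. blinfun_apply g x = dmod f x"
    by (rule positive_cone_extension[of "dmod f"]) (auto simp: dmod_add dmod_scaleR dmod_nonneg)
  from someI_ex[OF this] show "0 \<le> x \<Longrightarrow> ?thesis" by (simp add: dual_abs_def)
qed

text \<open>Type class instances of \<^type>\<open>blinfun\<close> must be polymorphic in both arguments, so the
  lattice structure of the dual is declared for every copy \<open>'b\<close> of the real line.\<close>

class real_line = banach +
  fixes to_real :: "'a \<Rightarrow> real"
  assumes to_real_add: "to_real (x + y) = to_real x + to_real y"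
    and to_real_scaleR: "to_real (r *\<^sub>R x) = r * to_real x"
    and norm_eq_abs_to_real: "norm x = \<bar>to_real x\<bar>"
    and surj_to_real: "surj to_real"

lemma bounded_linear_to_real: "bounded_linear (to_real :: 'a::real_line \<Rightarrow> real)"
  by (rule bounded_linear_intro[where K = 1]) (simp_all add: to_real_add to_real_scaleR norm_eq_abs_to_real)

lemmas to_real_diff = linear_diff[OF bounded_linear.linear[OF bounded_linear_to_real]]
lemmas to_real_0 = linear_0[OF bounded_linear.linear[OF bounded_linear_to_real]]
lemmas to_real_minus = linear_neg[OF bounded_linear.linear[OF bounded_linear_to_real]]

lemma inj_to_real: "inj (to_real :: 'a::real_line \<Rightarrow> real)"
proof (rule injI)
  fix x y :: 'a assume "to_real x = to_real y"
  then have "norm (x - y) = 0" by (simp add: norm_eq_abs_to_real to_real_diff)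
  then show "x = y" by simp
qed

lemma bounded_linear_inv_to_real: "bounded_linear (inv to_real :: real \<Rightarrow> 'a::real_line)"
proof (rule bounded_linear_intro[where K = 1])
  have *: "to_real (inv to_real r :: 'a) = r" for r by (simp add: surj_to_real surj_f_inv_f)
  show "inv to_real (x + y) = (inv to_real x + inv to_real y :: 'a)" for x y
    by (rule injD[OF inj_to_real]) (simp add: * to_real_add)
  show "inv to_real (r *\<^sub>R x) = (r *\<^sub>R inv to_real x :: 'a)" for r x
    by (rule injD[OF inj_to_real]) (simp add: * to_real_scaleR)
  show "norm (inv to_real x :: 'a) \<le> norm x * 1" for x by (simp add: * norm_eq_abs_to_real)
qed

instantiation real :: real_line
begin
definition "to_real_real (x :: real) = x"
instance by standard (auto simp: to_real_real_def surj_def)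
end

definition to_dual :: "('a::banach_lattice \<Rightarrow>\<^sub>L 'b::real_line) \<Rightarrow> 'a \<Rightarrow>\<^sub>L real" where
  "to_dual f = Blinfun (\<lambda>x. to_real (blinfun_apply f x))"

lemma to_dual_apply: "blinfun_apply (to_dual f) x = to_real (blinfun_apply f x)"
  unfolding to_dual_def
  by (rule bounded_linear_Blinfun_apply[THEN fun_cong])
    (intro bounded_linear_compose[OF bounded_linear_to_real] blinfun.bounded_linear_right)

definition blmod :: "('a::banach_lattice \<Rightarrow>\<^sub>L 'b::real_line) \<Rightarrow> 'a \<Rightarrow>\<^sub>L 'b" where
  "blmod f = Blinfun (\<lambda>x. inv to_real (blinfun_apply (dual_abs (to_dual f)) x))"

lemma to_real_blmod: "0 \<le> x \<Longrightarrow> to_real (blinfun_apply (blmod f) x) = dmod (to_dual f) x"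
  unfolding blmod_def
  by (subst bounded_linear_Blinfun_apply)
    (auto intro: bounded_linear_compose[OF bounded_linear_inv_to_real] blinfun.bounded_linear_right
      simp: surj_to_real surj_f_inv_f dual_abs_apply)

instantiation blinfun :: (banach_lattice, real_line) banach_lattice
begin

definition less_eq_blinfun :: "'a \<Rightarrow>\<^sub>L 'b \<Rightarrow> 'a \<Rightarrow>\<^sub>L 'b \<Rightarrow> bool" where
  "less_eq_blinfun f g \<longleftrightarrow> (\<forall>x\<ge>0. to_real (blinfun_apply f x) \<le> to_real (blinfun_apply g x))"

definition less_blinfun :: "'a \<Rightarrow>\<^sub>L 'b \<Rightarrow> 'a \<Rightarrow>\<^sub>L 'b \<Rightarrow> bool" where
  "less_blinfun f g \<longleftrightarrow> f \<le> g \<and> \<not> g \<le> f"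

text \<open>The vector lattice identity sup f g = (f + g + |f - g|) / 2 read as a definition: the
  modulus is the one lattice operation available so far. The infimum is treated alike.\<close>

definition sup_blinfun :: "'a \<Rightarrow>\<^sub>L 'b \<Rightarrow> 'a \<Rightarrow>\<^sub>L 'b \<Rightarrow> 'a \<Rightarrow>\<^sub>L 'b" where
  "sup_blinfun f g = (1 / 2) *\<^sub>R (f + g + blmod (f - g))"

definition inf_blinfun :: "'a \<Rightarrow>\<^sub>L 'b \<Rightarrow> 'a \<Rightarrow>\<^sub>L 'b \<Rightarrow> 'a \<Rightarrow>\<^sub>L 'b" where
  "inf_blinfun f g = (1 / 2) *\<^sub>R (f + g - blmod (f - g))"

instance
proof
  note ap = blinfun.add_left blinfun.diff_left blinfun.minus_left blinfun.scaleR_left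
    to_real_add to_real_diff to_real_minus to_real_scaleR to_real_0
  fix f g h :: "'a \<Rightarrow>\<^sub>L 'b" and r s :: real
  show "f < g \<longleftrightarrow> f \<le> g \<and> \<not> g \<le> f" by (rule less_blinfun_def)
  show "f \<le> f" by (simp add: less_eq_blinfun_def)
  show "f \<le> g \<Longrightarrow> g \<le> h \<Longrightarrow> f \<le> h" unfolding less_eq_blinfun_def by (meson order_trans)
  have anti: "f = g" if "f \<le> g" "g \<le> f" for f g :: "'a \<Rightarrow>\<^sub>L 'b"
  proof -
    from that have "to_real (blinfun_apply f x) = to_real (blinfun_apply g x)" if "0 \<le> x" for x
      using that unfolding less_eq_blinfun_def by (meson order_antisym)
    then have *: "blinfun_apply f x = blinfun_apply g x" if "0 \<le> x" for x
      using that injD[OF inj_to_real] by blast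
    show "f = g"
    proof (rule blinfun_eqI)
      fix x
      have "blinfun_apply f (pprt x - pprt (- x)) = blinfun_apply g (pprt x - pprt (- x))"
        by (simp only: blinfun.diff_right * zero_le_pprt)
      then show "blinfun_apply f x = blinfun_apply g x" by (simp add: pprt_minus_pprt[symmetric])
    qed
  qed
  show "f \<le> g \<Longrightarrow> g \<le> f \<Longrightarrow> f = g" by (rule anti)
  show "f \<le> g \<Longrightarrow> h + f \<le> h + g" by (simp add: less_eq_blinfun_def ap)
  show "f \<le> g \<Longrightarrow> 0 \<le> r \<Longrightarrow> r *\<^sub>R f \<le> r *\<^sub>R g"
    by (simp add: less_eq_blinfun_def ap mult_left_mono)
  show "r \<le> s \<Longrightarrow> 0 \<le> f \<Longrightarrow> r *\<^sub>R f \<le> s *\<^sub>R f"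
    by (simp add: less_eq_blinfun_def ap mult_right_mono)
  have blmod_ge: "f \<le> blmod f" "- f \<le> blmod f" for f :: "'a \<Rightarrow>\<^sub>L 'b"
  proof -
    have "\<bar>to_real (blinfun_apply f x)\<bar> \<le> to_real (blinfun_apply (blmod f) x)" if "0 \<le> x" for x
      using dmod_upper[of x x "to_dual f"] that by (simp add: to_real_blmod to_dual_apply)
    then show "f \<le> blmod f" "- f \<le> blmod f"
      by (auto simp: less_eq_blinfun_def ap abs_le_iff)
  qed
  \<comment> \<open>With \<open>blmod_ge\<close> this makes \<open>blmod f\<close> the least upper
    bound of \<open>f\<close> and \<open>- f\<close>. If \<open>h\<close> dominates both, then |f y|
    is at most \<open>h\<close> at the sum of the two parts of \<open>y\<close>, which is
    \<open>h\<close> at \<open>lmod y\<close>.\<close>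
  have blmod_le: "blmod f \<le> h" if "f \<le> h" "- f \<le> h" for f h :: "'a \<Rightarrow>\<^sub>L 'b"
    unfolding less_eq_blinfun_def
  proof (intro allI impI)
    fix x :: 'a assume "0 \<le> x"
    have h: "\<bar>to_real (blinfun_apply f z)\<bar> \<le> to_real (blinfun_apply h z)" if "0 \<le> z" for z
      using that \<open>f \<le> h\<close> \<open>- f \<le> h\<close> by (auto simp: less_eq_blinfun_def ap abs_le_iff)
    have "dmod (to_dual f) x \<le> to_real (blinfun_apply h x)"
    proof (rule dmod_least)
      fix y assume "lmod y \<le> x"
      have "\<bar>to_real (blinfun_apply f y)\<bar> = \<bar>to_real (blinfun_apply f (pprt y - pprt (- y)))\<bar>"
        by (simp add: pprt_minus_pprt[symmetric])
      also have "\<dots> \<le> to_real (blinfun_apply h (pprt y)) + to_real (blinfun_apply h (pprt (- y)))"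
        unfolding blinfun.diff_right to_real_diff using h[of "pprt y"] h[of "pprt (- y)"] by simp
      also have "\<dots> = to_real (blinfun_apply h (lmod y))"
        by (simp add: lmod_eq_pprt blinfun.add_right to_real_add)
      also have "\<dots> \<le> to_real (blinfun_apply h x)"
        using h[of "x - lmod y"] \<open>lmod y \<le> x\<close> by (simp add: blinfun.diff_right to_real_diff)
      finally show "\<bar>blinfun_apply (to_dual f) y\<bar> \<le> to_real (blinfun_apply h x)"
        by (simp add: to_dual_apply)
    qed fact
    then show "to_real (blinfun_apply (blmod f) x) \<le> to_real (blinfun_apply h x)"
      using \<open>0 \<le> x\<close> by (simp add: to_real_blmod)
  qed
  have leI: "f \<le> g" if "\<And>x. 0 \<le> x \<Longrightarrow> to_real (blinfun_apply f x) \<le> to_real (blinfun_apply g x)"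
    for f g :: "'a \<Rightarrow>\<^sub>L 'b"
    using that by (simp add: less_eq_blinfun_def)
  have leD: "to_real (blinfun_apply f x) \<le> to_real (blinfun_apply g x)" if "f \<le> g" "0 \<le> x"
    for f g :: "'a \<Rightarrow>\<^sub>L 'b" and x
    using that by (simp add: less_eq_blinfun_def)
  note ge = blmod_ge[of "f - g", THEN leD, unfolded ap]
  show "inf f g \<le> f" by (rule leI, drule ge(2)) (simp add: inf_blinfun_def ap)
  show "inf f g \<le> g" by (rule leI, drule ge(1)) (simp add: inf_blinfun_def ap)
  show "f \<le> sup f g" by (rule leI, drule ge(1)) (simp add: sup_blinfun_def ap)
  show "g \<le> sup f g" by (rule leI, drule ge(2)) (simp add: sup_blinfun_def ap)
  show "h \<le> f \<Longrightarrow> h \<le> g \<Longrightarrow> h \<le> inf f g"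
  proof -
    assume "h \<le> f" "h \<le> g"
    note D = this[THEN leD]
    \<comment> \<open>\<open>f - g\<close> and \<open>g - f\<close> lie below
      \<open>f + g - 2 *\<^sub>R h\<close> exactly because \<open>h\<close> is below
      \<open>g\<close> and below \<open>f\<close>; halving gives the claim.\<close>
    have "blmod (f - g) \<le> f + g - 2 *\<^sub>R h"
      by (intro blmod_le leI; frule D(1); drule D(2); simp add: ap)
    from leD[OF this] show "h \<le> inf f g" by (intro leI) (force simp: inf_blinfun_def ap)
  qed
  show "g \<le> f \<Longrightarrow> h \<le> f \<Longrightarrow> sup g h \<le> f"
  proof -
    assume "g \<le> f" "h \<le> f"
    note D = this[THEN leD]
    have "blmod (g - h) \<le> 2 *\<^sub>R f - g - h"
      by (intro blmod_le leI; frule D(1); drule D(2); simp add: ap)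
    from leD[OF this] show "sup g h \<le> f" by (intro leI) (force simp: sup_blinfun_def ap)
  qed
  \<comment> \<open>By its definition \<open>sup f (- f)\<close> is half the modulus of
    \<open>f + f\<close>, so doubling has to be pulled out of \<open>blmod\<close> before the norm
    axiom can be checked.\<close>
  have sup_blmod: "sup f (- f) = blmod f" for f :: "'a \<Rightarrow>\<^sub>L 'b"
  proof -
    have "blmod (f + f) = blmod f + blmod f"
    proof (rule anti)
      note D = blmod_ge[of f, THEN leD]
      show "blmod (f + f) \<le> blmod f + blmod f"
        by (intro blmod_le leI; frule D(1); drule D(2); simp add: ap)
      note D2 = blmod_ge[of "f + f", THEN leD, unfolded ap]
      have "blmod f \<le> (1 / 2) *\<^sub>R blmod (f + f)"
        by (intro blmod_le leI; frule D2(1); drule D2(2); simp add: ap)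
      from leD[OF this] show "blmod f + blmod f \<le> blmod (f + f)" by (intro leI) (force simp: ap)
    qed
    then show ?thesis by (simp add: sup_blinfun_def scaleR_2[symmetric])
  qed
  show "norm f \<le> norm g" if "sup f (- f) \<le> sup g (- g)"
  proof (rule norm_blinfun_bound)
    fix x
    have "norm (blinfun_apply f x) = \<bar>blinfun_apply (to_dual f) x\<bar>"
      by (simp add: to_dual_apply norm_eq_abs_to_real)
    also have "\<dots> \<le> dmod (to_dual f) (lmod x)" by (simp add: dmod_upper)
    also have "\<dots> \<le> dmod (to_dual g) (lmod x)"
      using that by (simp add: sup_blmod less_eq_blinfun_def to_real_blmod)
    also have "\<dots> \<le> norm g * norm x"
    proof (rule dmod_least)
      fix y assume "lmod y \<le> lmod x"
      have "\<bar>blinfun_apply (to_dual g) y\<bar> = norm (blinfun_apply g y)"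
        by (simp add: to_dual_apply norm_eq_abs_to_real)
      also have "\<dots> \<le> norm g * norm y" by (rule norm_blinfun)
      also have "\<dots> \<le> norm g * norm x"
        using \<open>lmod y \<le> lmod x\<close> by (simp add: lmod_le_norm mult_left_mono)
      finally show "\<bar>blinfun_apply (to_dual g) y\<bar> \<le> norm g * norm x" .
    qed simp
    finally show "norm (blinfun_apply f x) \<le> norm g * norm x" .
  qed simp
qed

end

section \<open>The dual order and the notions of the statement\<close>

lemma dual_le_iff:
  fixes f g :: "'a::banach_lattice \<Rightarrow>\<^sub>L real"
  shows "f \<le> g \<longleftrightarrow> (\<forall>x\<ge>0. blinfun_apply f x \<le> blinfun_apply g x)"
  by (simp add: less_eq_blinfun_def to_real_real_def)

lemma dual_leD:
  fixes f g :: "'a::banach_lattice \<Rightarrow>\<^sub>L real"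
  shows "f \<le> g \<Longrightarrow> 0 \<le> x \<Longrightarrow> blinfun_apply f x \<le> blinfun_apply g x"
  by (simp add: dual_le_iff)

lemma dual_nonneg_mono:
  fixes f :: "'a::banach_lattice \<Rightarrow>\<^sub>L real"
  shows "0 \<le> f \<Longrightarrow> x \<le> y \<Longrightarrow> blinfun_apply f x \<le> blinfun_apply f y"
  using dual_leD[of 0 f "y - x"] by (simp add: blinfun.diff_right)

lemma abs_apply_le:
  fixes f :: "'a::banach_lattice \<Rightarrow>\<^sub>L real"
  shows "\<bar>blinfun_apply f y\<bar> \<le> blinfun_apply (lmod f) (lmod y)"
proof -
  have *: "\<bar>blinfun_apply f z\<bar> \<le> blinfun_apply (lmod f) z" if "0 \<le> z" for z
    using dual_leD[OF lmod_ge(1)[of f] that] dual_leD[OF lmod_ge(2)[of f] that]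
    by (simp add: blinfun.minus_left abs_le_iff)
  have "blinfun_apply f y = blinfun_apply f (pprt y) - blinfun_apply f (pprt (- y))"
    by (simp only: blinfun.diff_right[symmetric] pprt_minus_pprt[symmetric])
  moreover have "blinfun_apply (lmod f) (lmod y) = blinfun_apply (lmod f) (pprt y) + blinfun_apply (lmod f) (pprt (- y))"
    by (simp only: lmod_eq_pprt[of y] blinfun.add_right)
  ultimately show ?thesis using *[of "pprt y"] *[of "pprt (- y)"] by simp
qed

lemma lmod_dual_apply:
  fixes f :: "'a::banach_lattice \<Rightarrow>\<^sub>L real"
  assumes "0 \<le> x" shows "blinfun_apply (lmod f) x = dmod f x"
proof (rule antisym)
  have "lmod f \<le> dual_abs f"
    unfolding lmod_le_iff unfolding dual_le_iff
    using dmod_upper[of z z f for z] by (auto simp: dual_abs_apply blinfun.minus_left abs_le_iff)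
  from dual_leD[OF this assms] show "blinfun_apply (lmod f) x \<le> dmod f x"
    using assms by (simp add: dual_abs_apply)
  show "dmod f x \<le> blinfun_apply (lmod f) x"
  proof (rule dmod_least[OF assms])
    fix y assume "lmod y \<le> x"
    then have "blinfun_apply (lmod f) (lmod y) \<le> blinfun_apply (lmod f) x"
      by (intro dual_nonneg_mono) simp_all
    then show "\<bar>blinfun_apply f y\<bar> \<le> blinfun_apply (lmod f) x"
      using abs_apply_le[of f y] by simp
  qed
qed

lemma dual_sol_eq_sol: "dual_sol B = sol B"
  by (auto simp: dual_sol_def sol_def dual_le_iff lmod_dual_apply)

text \<open>The infimum in the dual is always below the displayed INF, which settles one direction.
  For the other, disjointness turns |f| + |g| into the modulus of |f| - |g|, and an almost extremal
  point of that modulus yields a splitting of \<open>x\<close> with small value.\<close>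

lemma dual_disjoint_iff:
  fixes f g :: "'a::banach_lattice \<Rightarrow>\<^sub>L real"
  shows "dual_disjoint f g \<longleftrightarrow> inf (lmod f) (lmod g) = 0"
proof -
  define h where "h = inf (lmod f) (lmod g)"
  have h0: "0 \<le> h" by (simp add: h_def)
  have low: "blinfun_apply h x \<le> dmod f y + dmod g (x - y)" if "y \<in> {0..x}" for x y
  proof -
    have "blinfun_apply h x = blinfun_apply h y + blinfun_apply h (x - y)"
      by (simp add: blinfun.diff_right)
    also have "\<dots> \<le> blinfun_apply (lmod f) y + blinfun_apply (lmod g) (x - y)"
      using that by (intro add_mono dual_leD) (auto simp: h_def)
    finally show ?thesis using that by (simp add: lmod_dual_apply)
  qed
  have inf_le: "blinfun_apply h x \<le> (INF y\<in>{0..x}. dmod f y + dmod g (x - y))" if "0 \<le> x" for x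
    by (rule cINF_greatest) (use that low in auto)
  show ?thesis
  proof
    assume "dual_disjoint f g"
    then have "h \<le> 0" using inf_le by (simp add: dual_disjoint_def dual_le_iff)
    with h0 show "inf (lmod f) (lmod g) = 0" unfolding h_def by (intro antisym)
  next
    assume "inf (lmod f) (lmod g) = 0"
    then have eq: "lmod f + lmod g = lmod (lmod f - lmod g)"
    proof -
      \<comment> \<open>The left side is twice the supremum of the two moduli, and for disjoint
        elements the supremum is the sum.\<close>
      have "lmod (lmod f - lmod g) + (lmod f + lmod g) = sup (lmod f + lmod f) (lmod g + lmod g)"
        unfolding lmod_def[of "lmod f - lmod g"] add_sup_distrib_right by (simp add: algebra_simps)
      also have "\<dots> = sup (lmod f) (lmod g) + sup (lmod f) (lmod g)"
        using scaleR_sup[of 2 "lmod f" "lmod g"] by (simp add: scaleR_2)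
      also have "sup (lmod f) (lmod g) = lmod f + lmod g"
        using add_eq_inf_sup[of "lmod f" "lmod g"] \<open>inf (lmod f) (lmod g) = 0\<close> by simp
      finally show ?thesis by simp
    qed
    show "dual_disjoint f g" unfolding dual_disjoint_def
    proof (intro allI impI antisym)
      fix x :: 'a assume x: "0 \<le> x"
      have bdd: "bdd_below ((\<lambda>y. dmod f y + dmod g (x - y)) ` {0..x})"
        using dual_leD[OF h0 x] low by (intro bdd_belowI2[of _ "blinfun_apply h x"]) auto
      show "0 \<le> (INF y\<in>{0..x}. dmod f y + dmod g (x - y))"
        using inf_le[OF x] dual_leD[OF h0 x] by simp
      show "(INF y\<in>{0..x}. dmod f y + dmod g (x - y)) \<le> 0"
      proof (rule field_le_epsilon)
        fix e :: real assume "0 < e"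
        let ?d = "lmod f - lmod g"
        have "blinfun_apply (lmod f + lmod g) x - e < dmod ?d x"
          using lmod_dual_apply[OF x, of ?d] \<open>0 < e\<close> by (simp add: eq)
        then obtain y where y: "lmod y \<le> x" "blinfun_apply (lmod f + lmod g) x - e < \<bar>blinfun_apply ?d y\<bar>"
          using dmod_approx[OF x] by blast
        \<comment> \<open>The sign is chosen so that \<open>?d\<close> is nonpositive at
          \<open>z\<close>.\<close>
        define z where "z = (if blinfun_apply ?d y \<ge> 0 then - y else y)"
        have z: "lmod z \<le> x" using y by (simp add: z_def)
        have dz: "blinfun_apply (lmod f + lmod g) x - e < - blinfun_apply ?d z"
          using y(2) by (auto simp: z_def blinfun.minus_right)
        \<comment> \<open>At \<open>z\<close>, |f| is close to its value at \<open>- x\<close> and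
          |g| close to its value at \<open>x\<close>. Hence the midpoint of \<open>x\<close> and
          \<open>z\<close> is almost null for |f| and its complement in \<open>x\<close> almost null
          for |g|.\<close>
        define w where "w = (1 / 2) *\<^sub>R (x + z)"
        have xw: "x - w = (1 / 2) *\<^sub>R (x - z)"
          by (simp add: w_def scaleR_diff_right scaleR_add_right)
            (metis add_diff_cancel_right' scaleR_half_double scaleR_add_right)
        have pos: "0 \<le> x + z" "0 \<le> x - z"
          using z add_mono[of "- z" x z z] by (auto simp: lmod_le_iff)
        have w: "w \<in> {0..x}"
        proof -
          have "0 \<le> w" unfolding w_def by (rule scaleR_nonneg_nonneg) (simp_all add: pos)
          moreover have "0 \<le> x - w" unfolding xw by (rule scaleR_nonneg_nonneg) (use pos in simp_all)
          ultimately show ?thesis by simp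
        qed
        have "(INF y\<in>{0..x}. dmod f y + dmod g (x - y)) \<le> dmod f w + dmod g (x - w)"
          by (rule cINF_lower[OF bdd w])
        also have "\<dots> = blinfun_apply (lmod f) w + blinfun_apply (lmod g) (x - w)"
          using w by (simp add: lmod_dual_apply)
        also have "\<dots> = (blinfun_apply (lmod f + lmod g) x + blinfun_apply ?d z) / 2"
          unfolding xw unfolding w_def
          by (simp add: blinfun.add_right blinfun.diff_right blinfun.scaleR_right
              blinfun.add_left blinfun.diff_left field_simps)
        also have "\<dots> \<le> 0 + e" using dz \<open>0 < e\<close> by simp
        finally show "(INF y\<in>{0..x}. dmod f y + dmod g (x - y)) \<le> 0 + e" .
      qed
    qed
  qed
qed

lemma dual_disjoint_seq_iff: "dual_disjoint_seq f \<longleftrightarrow> disjoint_seq f"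
  by (simp add: dual_disjoint_seq_def disjoint_seq_def dual_disjoint_iff)

text \<open>The component of \<open>f\<close> in the band carried by \<open>u\<close>.\<close>

lemma dual_component:
  fixes f :: "'a::banach_lattice \<Rightarrow>\<^sub>L real"
  assumes f: "0 \<le> f" and u: "0 \<le> u"
  obtains g where "0 \<le> g" "g \<le> f" "blinfun_apply g u = blinfun_apply f u"
    "\<And>w. inf w u = 0 \<Longrightarrow> blinfun_apply g w = 0"
    "\<And>z e. 0 \<le> z \<Longrightarrow> 0 < e \<Longrightarrow> \<exists>t\<ge>0. blinfun_apply g z < blinfun_apply f (inf z (t *\<^sub>R u)) + e"
proof -
  \<comment> \<open>The supremum of \<open>inf z (t *\<^sub>R u)\<close> over \<open>t\<close> is
    the band component of \<open>z\<close> along \<open>u\<close>. It need not exist in the space,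
    but its value under \<open>f\<close> does. Real \<open>t\<close> makes scaling of
    \<open>z\<close> a change of parameter.\<close>
  define p where "p z = (SUP t\<in>{0..}. blinfun_apply f (inf z (t *\<^sub>R u)))" for z
  have bdd: "bdd_above ((\<lambda>t. blinfun_apply f (inf z (t *\<^sub>R u))) ` {0..})" for z
    by (rule bdd_aboveI2[of _ _ "blinfun_apply f z"]) (simp add: dual_nonneg_mono[OF f])
  have upper: "blinfun_apply f (inf z (t *\<^sub>R u)) \<le> p z" if "0 \<le> t" for z t
    unfolding p_def by (rule cSUP_upper) (use that bdd in auto)
  have least: "p z \<le> c" if "\<And>t. 0 \<le> t \<Longrightarrow> blinfun_apply f (inf z (t *\<^sub>R u)) \<le> c" for z c
    unfolding p_def by (rule cSUP_least) (use that in auto)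
  have tu: "0 \<le> t *\<^sub>R u" if "0 \<le> t" for t using that u by (simp add: scaleR_nonneg_nonneg)
  have nonneg: "0 \<le> p z" if "0 \<le> z" for z
    using upper[of 0 z] that by (simp add: inf_absorb2)
  have add: "p (x + y) = p x + p y" if "0 \<le> x" "0 \<le> y" for x y
  proof (rule antisym)
    show "p (x + y) \<le> p x + p y"
    proof (rule least)
      fix t :: real assume "0 \<le> t"
      have "blinfun_apply f (inf (x + y) (t *\<^sub>R u)) \<le> blinfun_apply f (inf x (t *\<^sub>R u) + inf y (t *\<^sub>R u))"
        using that \<open>0 \<le> t\<close> tu by (intro dual_nonneg_mono[OF f] inf_add_le)
      then show "blinfun_apply f (inf (x + y) (t *\<^sub>R u)) \<le> p x + p y"
        using upper[OF \<open>0 \<le> t\<close>, of x] upper[OF \<open>0 \<le> t\<close>, of y] by (simp add: blinfun.add_right)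
    qed
    have *: "blinfun_apply f (inf x (s *\<^sub>R u)) + blinfun_apply f (inf y (t *\<^sub>R u)) \<le> p (x + y)"
      if "0 \<le> s" "0 \<le> t" for s t
    proof -
      have "inf x (s *\<^sub>R u) + inf y (t *\<^sub>R u) \<le> inf (x + y) ((s + t) *\<^sub>R u)"
        by (simp add: add_mono scaleR_add_left)
      from dual_nonneg_mono[OF f this] upper[of "s + t" "x + y"] that show ?thesis
        by (simp add: blinfun.add_right)
    qed
    have "p x \<le> p (x + y) - p y"
    proof (rule least)
      fix s :: real assume s: "0 \<le> s"
      have "p y \<le> p (x + y) - blinfun_apply f (inf x (s *\<^sub>R u))"
      proof (rule least)
        fix t :: real assume "0 \<le> t"
        from *[OF s this] show "blinfun_apply f (inf y (t *\<^sub>R u)) \<le> p (x + y) - blinfun_apply f (inf x (s *\<^sub>R u))"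
          by simp
      qed
      then show "blinfun_apply f (inf x (s *\<^sub>R u)) \<le> p (x + y) - p y" by simp
    qed
    then show "p x + p y \<le> p (x + y)" by simp
  qed
  have scale_le: "p (r *\<^sub>R x) \<le> r * p x" if "0 < r" "0 \<le> x" for r x
  proof (rule least)
    fix t :: real assume "0 \<le> t"
    have "inf (r *\<^sub>R x) (t *\<^sub>R u) = r *\<^sub>R inf x ((t / r) *\<^sub>R u)"
      using that by (simp add: scaleR_inf)
    then show "blinfun_apply f (inf (r *\<^sub>R x) (t *\<^sub>R u)) \<le> r * p x"
      using upper[of "t / r" x] \<open>0 \<le> t\<close> that by (simp add: blinfun.scaleR_right)
  qed
  have scale: "p (r *\<^sub>R x) = r * p x" if "0 < r" "0 \<le> x" for r x
  proof (rule antisym)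
    have "p x \<le> (1 / r) * p (r *\<^sub>R x)"
      using scale_le[of "1 / r" "r *\<^sub>R x"] that by (simp add: scaleR_nonneg_nonneg)
    then show "r * p x \<le> p (r *\<^sub>R x)" using that by (simp add: field_simps)
  qed (rule scale_le[OF that])
  obtain g :: "'a \<Rightarrow>\<^sub>L real" where g: "\<And>z. 0 \<le> z \<Longrightarrow> blinfun_apply g z = p z"
    by (rule positive_cone_extension[of p]) (use add scale nonneg in auto)
  have le: "p z \<le> blinfun_apply f z" for z
    by (rule least) (simp add: dual_nonneg_mono[OF f])
  show thesis
  proof
    show "0 \<le> g" "g \<le> f" using g nonneg le by (auto simp: dual_le_iff)
    show "blinfun_apply g u = blinfun_apply f u"
      using upper[of 1 u] le[of u] u by (simp add: g)
    show "blinfun_apply g w = 0" if "inf w u = 0" for w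
    proof -
      have "0 \<le> w" using that by (metis inf.cobounded1)
      moreover have "p w \<le> 0" by (rule least) (simp add: disjoint_scaleR[OF that])
      ultimately show ?thesis using nonneg[of w] by (simp add: g)
    qed
    \<comment> \<open>A single multiple of \<open>u\<close> suffices up to \<open>e\<close>. This
      lets \<open>sum_dual_components_le\<close> compare several components with \<open>f\<close> at
      once.\<close>
    show "\<exists>t\<ge>0. blinfun_apply g z < blinfun_apply f (inf z (t *\<^sub>R u)) + e" if "0 \<le> z" "0 < e" for z e
    proof (rule ccontr)
      assume "\<not> ?thesis"
      then have "p z \<le> blinfun_apply g z - e" by (intro least) force
      then show False using that by (simp add: g)
    qed
  qed
qed

text \<open>The component of \<open>f\<close> carried by the positive part of \<open>y\<close>
  vanishes on the negative part, which is disjoint from it.\<close>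

lemma dual_attains_pprt:
  fixes f :: "'a::banach_lattice \<Rightarrow>\<^sub>L real"
  assumes "0 \<le> f"
  obtains g where "0 \<le> g" "g \<le> f" "blinfun_apply g y = blinfun_apply f (pprt y)"
proof -
  obtain g where g: "0 \<le> g" "g \<le> f" "blinfun_apply g (pprt y) = blinfun_apply f (pprt y)"
    "\<And>w. inf w (pprt y) = 0 \<Longrightarrow> blinfun_apply g w = 0"
    using dual_component[OF assms zero_le_pprt[of y]] by metis
  have "blinfun_apply g y = blinfun_apply g (pprt y) - blinfun_apply g (pprt (- y))"
    by (simp only: blinfun.diff_right[symmetric] pprt_minus_pprt[symmetric])
  moreover have "blinfun_apply g (pprt (- y)) = 0"
    by (rule g(4)) (simp only: inf_commute pprt_disjoint)
  ultimately show thesis using g that by simp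
qed

text \<open>\<open>f\<close> at \<open>lmod y\<close> is the sum of its values at the two parts of
  \<open>y\<close>. Each is attained at \<open>y\<close>, up to sign, by a functional below
  \<open>f\<close>, and one of them is at least half of the sum.\<close>

lemma dual_attains_half_lmod:
  fixes f :: "'a::banach_lattice \<Rightarrow>\<^sub>L real"
  assumes "0 \<le> f"
  obtains g where "0 \<le> g" "g \<le> f" "blinfun_apply f (lmod y) \<le> 2 * \<bar>blinfun_apply g y\<bar>"
proof -
  obtain g where g: "0 \<le> g" "g \<le> f" "blinfun_apply g y = blinfun_apply f (pprt y)"
    using dual_attains_pprt[OF assms] by blast
  obtain h where h: "0 \<le> h" "h \<le> f" "blinfun_apply h (- y) = blinfun_apply f (pprt (- y))"
    using dual_attains_pprt[OF assms] by blast
  have "blinfun_apply f (lmod y) = blinfun_apply g y + blinfun_apply h (- y)"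
    by (simp only: g h lmod_eq_pprt[of y] blinfun.add_right)
  then have "blinfun_apply f (lmod y) \<le> 2 * \<bar>blinfun_apply g y\<bar> \<or> blinfun_apply f (lmod y) \<le> 2 * \<bar>blinfun_apply h y\<bar>"
    by (auto simp: blinfun.minus_right)
  then show thesis using that g h by blast
qed

section \<open>Hahn--Banach, uniform boundedness and weak compactness\<close>

definition sublinear :: "('a::real_vector \<Rightarrow> real) \<Rightarrow> bool" where
  "sublinear q \<longleftrightarrow> (\<forall>x y. q (x + y) \<le> q x + q y) \<and> (\<forall>r x. 0 < r \<longrightarrow> q (r *\<^sub>R x) = r * q x)"

lemma sublinear_add: "sublinear q \<Longrightarrow> q (x + y) \<le> q x + q y"
  and sublinear_scaleR: "sublinear q \<Longrightarrow> 0 < r \<Longrightarrow> q (r *\<^sub>R x) = r * q x"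
  by (simp_all add: sublinear_def)

lemma sublinear_0:
  assumes "sublinear q" shows "q 0 = 0"
  using sublinear_scaleR[OF assms, of 2 0] by simp

lemma sublinear_scaleR_nonneg: "sublinear q \<Longrightarrow> 0 \<le> r \<Longrightarrow> q (r *\<^sub>R x) = r * q x"
  by (cases "r = 0") (simp_all add: sublinear_0 sublinear_scaleR)

lemma sublinear_minus:
  assumes "sublinear q" shows "- q (- x) \<le> q x"
  using sublinear_add[OF assms, of x "- x"] sublinear_0[OF assms] by simp

text \<open>Lower bounds of chains for Zorn's lemma. The infimum is finite since
  \<open>q x \<ge> - q (- x) \<ge> - p (- x)\<close>; it is subadditive since of two members of a
  chain the smaller one can serve both summands.\<close>

lemma sublinear_cINF:
  fixes Q :: "('a::real_vector \<Rightarrow> real) set"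
  assumes "Q \<noteq> {}" and sub: "\<And>q. q \<in> Q \<Longrightarrow> sublinear q"
    and below: "\<And>q x. q \<in> Q \<Longrightarrow> q x \<le> p x"
    and chain: "\<And>q q'. q \<in> Q \<Longrightarrow> q' \<in> Q \<Longrightarrow> (\<forall>x. q x \<le> q' x) \<or> (\<forall>x. q' x \<le> q x)"
  shows "sublinear (\<lambda>x. INF q\<in>Q. q x)" "\<And>q x. q \<in> Q \<Longrightarrow> (INF q\<in>Q. q x) \<le> q x"
proof -
  have bdd: "bdd_below ((\<lambda>q. q x) ` Q)" for x
  proof (rule bdd_belowI2)
    fix q assume q: "q \<in> Q"
    show "- p (- x) \<le> q x" using sublinear_minus[OF sub[OF q], of x] below[OF q, of "- x"] by simp
  qed
  show low: "(INF q\<in>Q. q x) \<le> q x" if "q \<in> Q" for q x by (rule cINF_lower[OF bdd that])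
  have great: "c \<le> (INF q\<in>Q. q x)" if "\<And>q. q \<in> Q \<Longrightarrow> c \<le> q x" for c x
    by (rule cINF_greatest) (use that assms(1) in auto)
  show "sublinear (\<lambda>x. INF q\<in>Q. q x)" unfolding sublinear_def
  proof (intro conjI allI impI)
    fix x y
    have *: "(INF q\<in>Q. q (x + y)) \<le> q x + q' y" if "q \<in> Q" "q' \<in> Q" for q q'
      using chain[OF that]
    proof
      assume "\<forall>x. q x \<le> q' x"
      then show ?thesis using low[OF that(1), of "x + y"] sublinear_add[OF sub[OF that(1)], of x y]
        by (smt (verit))
    next
      assume "\<forall>x. q' x \<le> q x"
      then show ?thesis using low[OF that(2), of "x + y"] sublinear_add[OF sub[OF that(2)], of x y]
        by (smt (verit))
    qed
    have "(INF q\<in>Q. q (x + y)) - (INF q\<in>Q. q y) \<le> (INF q\<in>Q. q x)"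
    proof (rule great)
      fix q assume q: "q \<in> Q"
      have "(INF q\<in>Q. q (x + y)) - q x \<le> (INF q\<in>Q. q y)"
        by (rule great) (use *[OF q] in force)
      then show "(INF q\<in>Q. q (x + y)) - (INF q\<in>Q. q y) \<le> q x" by simp
    qed
    then show "(INF q\<in>Q. q (x + y)) \<le> (INF q\<in>Q. q x) + (INF q\<in>Q. q y)" by simp
  next
    fix r x assume r: "(0::real) < r"
    have *: "s * (INF q\<in>Q. q z) \<le> (INF q\<in>Q. q (s *\<^sub>R z))" if "0 < s" for s :: real and z
    proof (rule great)
      fix q assume q: "q \<in> Q"
      show "s * (INF q\<in>Q. q z) \<le> q (s *\<^sub>R z)"
        using low[OF q, of z] that by (simp add: sublinear_scaleR[OF sub[OF q]])
    qed
    show "(INF q\<in>Q. q (r *\<^sub>R x)) = r * (INF q\<in>Q. q x)"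
    proof (rule antisym)
      show "(INF q\<in>Q. q (r *\<^sub>R x)) \<le> r * (INF q\<in>Q. q x)"
        using *[of "1 / r" "r *\<^sub>R x"] r by (simp add: field_simps)
    qed (rule *[OF r])
  qed
qed

text \<open>\<open>q'\<close> lowers \<open>q\<close> unless \<open>q\<close> is already additive in
  direction \<open>y\<close>: if \<open>q' = q\<close>, then \<open>t = 1\<close> gives q x + q y <=
  q (x + y).\<close>

lemma sublinear_shift:
  fixes q :: "'a::real_vector \<Rightarrow> real"
  assumes q: "sublinear q"
  obtains q' where "sublinear q'" "\<And>x. q' x \<le> q x" "\<And>x t. 0 \<le> t \<Longrightarrow> q' x \<le> q (x + t *\<^sub>R y) - t * q y"
proof
  define q' where "q' x = (INF t\<in>{0..}. q (x + t *\<^sub>R y) - t * q y)" for x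
  have bdd: "bdd_below ((\<lambda>t. q (x + t *\<^sub>R y) - t * q y) ` {0..})" for x
  proof (rule bdd_belowI2)
    fix t :: real assume "t \<in> {0..}"
    then show "- q (- x) \<le> q (x + t *\<^sub>R y) - t * q y"
      using sublinear_add[OF q, of "x + t *\<^sub>R y" "- x"] sublinear_scaleR_nonneg[OF q, of t y] by simp
  qed
  show low: "q' x \<le> q (x + t *\<^sub>R y) - t * q y" if "0 \<le> t" for x t
    unfolding q'_def by (rule cINF_lower[OF bdd]) (use that in simp)
  have great: "c \<le> q' x" if "\<And>t. 0 \<le> t \<Longrightarrow> c \<le> q (x + t *\<^sub>R y) - t * q y" for c x
    unfolding q'_def by (rule cINF_greatest) (use that in auto)
  show "q' x \<le> q x" for x using low[of 0 x] by simp
  show "sublinear q'" unfolding sublinear_def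
  proof (intro conjI allI impI)
    fix x z
    have *: "q' (x + z) \<le> (q (x + s *\<^sub>R y) - s * q y) + (q (z + t *\<^sub>R y) - t * q y)" if "0 \<le> s" "0 \<le> t" for s t
      using low[of "s + t" "x + z"] sublinear_add[OF q, of "x + s *\<^sub>R y" "z + t *\<^sub>R y"] that
      by (simp add: algebra_simps)
    have "q' (x + z) - q' z \<le> q' x"
    proof (rule great)
      fix s :: real assume s: "0 \<le> s"
      have "q' (x + z) - (q (x + s *\<^sub>R y) - s * q y) \<le> q' z"
        by (rule great) (use *[OF s] in force)
      then show "q' (x + z) - q' z \<le> q (x + s *\<^sub>R y) - s * q y" by simp
    qed
    then show "q' (x + z) \<le> q' x + q' z" by simp
  next
    fix r x assume r: "(0::real) < r"
    have *: "s * q' z \<le> q' (s *\<^sub>R z)" if "0 < s" for s :: real and z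
    proof (rule great)
      fix t :: real assume t: "0 \<le> t"
      have "q (s *\<^sub>R z + t *\<^sub>R y) = s * q (z + (t / s) *\<^sub>R y)"
        using sublinear_scaleR[OF q that, of "z + (t / s) *\<^sub>R y"] that by (simp add: scaleR_add_right)
      moreover have "s * q' z \<le> s * (q (z + (t / s) *\<^sub>R y) - (t / s) * q y)"
        using low[of "t / s" z] t that by (intro mult_left_mono) auto
      ultimately show "s * q' z \<le> q (s *\<^sub>R z + t *\<^sub>R y) - t * q y"
        using that by (simp add: right_diff_distrib)
    qed
    show "q' (r *\<^sub>R x) = r * q' x"
    proof (rule antisym)
      show "q' (r *\<^sub>R x) \<le> r * q' x"
        using *[of "1 / r" "r *\<^sub>R x"] r by (simp add: field_simps)
    qed (rule *[OF r])
  qed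
qed

text \<open>Hahn--Banach: a pointwise minimal sublinear functional below \<open>p\<close> is not lowered by
  \<open>sublinear_shift\<close>, hence additive.\<close>

lemma sublinear_dominates_linear:
  fixes p :: "'a::real_vector \<Rightarrow> real"
  assumes p: "sublinear p"
  obtains f where "linear f" "\<And>x. f x \<le> p x"
proof -
  define A where "A = {q. sublinear q \<and> (\<forall>x. q x \<le> p x)}"
  \<comment> \<open>The order is reversed, so that a maximal element for Zorn is a pointwise minimal
    functional.\<close>
  have "\<exists>m\<in>A. \<forall>a\<in>A. (\<forall>x. a x \<le> m x) \<longrightarrow> a = m"
  proof (rule predicate_Zorn)
    show "partial_order_on A (relation_of (\<lambda>m a. \<forall>x. a x \<le> m x) A)"
      by (rule partial_order_on_relation_ofI) (auto intro: order_trans intro!: ext antisym)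
    fix C assume C: "C \<in> Chains (relation_of (\<lambda>m a. \<forall>x. a x \<le> m x) A)"
    then have CA: "C \<subseteq> A" by (auto simp: Chains_def relation_of_def)
    show "\<exists>u\<in>A. \<forall>a\<in>C. \<forall>x. u x \<le> a x"
    proof (cases "C = {}")
      case True
      then show ?thesis using p by (auto simp: A_def)
    next
      case False
      have ch: "(\<forall>x. q x \<le> q' x) \<or> (\<forall>x. q' x \<le> q x)" if "q \<in> C" "q' \<in> C" for q q'
        using C that by (auto simp: Chains_def relation_of_def)
      have sub: "sublinear q" "q x \<le> p x" if "q \<in> C" for q x using that CA by (auto simp: A_def)
      have I1: "sublinear (\<lambda>x. INF q\<in>C. q x)"
        by (rule sublinear_cINF(1)[of C p]) (use False sub ch in blast)+
      have I2: "(INF q\<in>C. q x) \<le> q x" if "q \<in> C" for q x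
        by (rule sublinear_cINF(2)[of C p]) (use False sub ch that in blast)+
      obtain q where "q \<in> C" using False by blast
      have "(INF q\<in>C. q x) \<le> p x" for x
        using I2[OF \<open>q \<in> C\<close>, of x] sub(2)[OF \<open>q \<in> C\<close>, of x] by (rule order_trans)
      then have "(\<lambda>x. INF q\<in>C. q x) \<in> A"
        using I1 by (simp add: A_def)
      then show ?thesis by (rule bexI[rotated]) (use I2 in blast)
    qed
  qed
  then obtain q where "q \<in> A" and min: "\<And>a. a \<in> A \<Longrightarrow> \<forall>x. a x \<le> q x \<Longrightarrow> a = q" by blast
  then have q: "sublinear q" "\<And>x. q x \<le> p x" by (auto simp: A_def)
  have add: "q (x + y) = q x + q y" for x y
  proof -
    obtain q' where q': "sublinear q'" "\<And>x. q' x \<le> q x" "\<And>x t. 0 \<le> t \<Longrightarrow> q' x \<le> q (x + t *\<^sub>R y) - t * q y"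
      using sublinear_shift[OF q(1)] by blast
    have "q' = q" using q'(1,2) order_trans[OF q'(2) q(2)] by (intro min) (auto simp: A_def)
    then show ?thesis using q'(3)[of 1 x] sublinear_add[OF q(1), of x y] by simp
  qed
  have minus: "q (- x) = - q x" for x using add[of x "- x"] sublinear_0[OF q(1)] by simp
  have "linear q"
  proof (rule linearI)
    fix r x
    show "q (r *\<^sub>R x) = r *\<^sub>R q x"
      using sublinear_scaleR_nonneg[OF q(1), of r x] sublinear_scaleR_nonneg[OF q(1), of "- r" x] minus[of "r *\<^sub>R x"]
      by (cases "0 \<le> r") auto
  qed (rule add)
  then show thesis using q(2) by (rule that)
qed

lemma norming_functional:
  fixes x :: "'a::real_normed_vector"
  obtains f :: "'a \<Rightarrow>\<^sub>L real" where "norm f \<le> 1" "blinfun_apply f x = norm x"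
proof -
  have n: "sublinear (norm :: 'a \<Rightarrow> real)" by (simp add: sublinear_def norm_triangle_ineq)
  \<comment> \<open>Shifting in direction \<open>x\<close> replaces extension from the line through
    \<open>x\<close>: \<open>t = 1\<close> yields \<open>q (- x) \<le> - norm x\<close>, so every
    linear functional below \<open>q\<close> is at least \<open>norm x\<close> at
    \<open>x\<close>.\<close>
  obtain q where q: "sublinear q" "\<And>z. q z \<le> norm z" "\<And>z t. 0 \<le> t \<Longrightarrow> q z \<le> norm (z + t *\<^sub>R x) - t * norm x"
    using sublinear_shift[OF n] by blast
  obtain f where f: "linear f" "\<And>z. f z \<le> q z" using sublinear_dominates_linear[OF q(1)] by blast
  have le: "\<bar>f z\<bar> \<le> norm z" for z
    using f(2)[of z] f(2)[of "- z"] q(2)[of z] q(2)[of "- z"] linear_neg[OF f(1), of z] by simp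
  have bl: "bounded_linear f"
    using f(1) le by (intro bounded_linear_intro[of f 1]) (auto simp: linear_add linear_scale)
  then have ap: "blinfun_apply (Blinfun f) = f" by (rule bounded_linear_Blinfun_apply)
  show thesis
  proof
    show "norm (Blinfun f) \<le> 1" by (rule norm_blinfun_bound) (use le in \<open>auto simp: ap\<close>)
    have "norm x \<le> f x"
      using f(2)[of "- x"] q(3)[of 1 "- x"] linear_neg[OF f(1), of x] by simp
    then show "blinfun_apply (Blinfun f) x = norm x" using le[of x] by (simp add: ap)
  qed
qed

text \<open>Sokal's elementary argument: each \<open>f\<close> has norm about \<open>r * norm f\<close> somewhere in every ball of
  radius \<open>r\<close>, so the limit of a rapidly shrinking sequence of such points is a point of
  unboundedness.\<close>

lemma uniform_boundedness:
  fixes S :: "('a::banach \<Rightarrow>\<^sub>L 'b::real_normed_vector) set"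
  assumes "\<And>x. bounded ((\<lambda>f. blinfun_apply f x) ` S)"
  shows "bounded S"
proof (rule ccontr)
  assume "\<not> bounded S"
  then have "\<exists>f\<in>S. 4 ^ n < norm f" for n :: nat unfolding bounded_iff by (meson not_le)
  then obtain T where T: "\<And>n::nat. T n \<in> S" "\<And>n. 4 ^ n < norm (T n)" by metis
  have step: "\<exists>x. norm (x - x0) \<le> r \<and> r * (3/4 * norm f) \<le> norm (blinfun_apply f x)"
    if "0 < r" "0 < norm f" for x0 r and f :: "'a \<Rightarrow>\<^sub>L 'b"
  proof -
    have "\<not> (\<forall>u. norm (blinfun_apply f u) \<le> 3/4 * norm f * norm u)"
    proof
      assume *: "\<forall>u. norm (blinfun_apply f u) \<le> 3/4 * norm f * norm u"
      have "norm f \<le> 3/4 * norm f" by (rule norm_blinfun_bound) (use * in auto)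
      then show False using that by simp
    qed
    then obtain u where u: "3/4 * norm f * norm u < norm (blinfun_apply f u)" by (auto simp: not_le)
    then have u0: "0 < norm u" by auto
    define v where "v = (r / norm u) *\<^sub>R u"
    have v: "norm v = r" using u0 that by (simp add: v_def)
    have "3/4 * norm f * r \<le> norm (blinfun_apply f v)"
      using u u0 that by (simp add: v_def blinfun.scaleR_right field_simps)
    \<comment> \<open>The vector \<open>f v\<close> is half the difference of the values at
      \<open>x0 + v\<close> and \<open>x0 - v\<close>, so one of these is at least as large in
      norm.\<close>
    moreover have "2 * norm (blinfun_apply f v) \<le> norm (blinfun_apply f (x0 + v)) + norm (blinfun_apply f (x0 - v))"
    proof -
      have "2 *\<^sub>R blinfun_apply f v = blinfun_apply f (x0 + v) - blinfun_apply f (x0 - v)"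
        by (simp add: blinfun.add_right blinfun.diff_right scaleR_2)
      then show ?thesis by (metis norm_triangle_ineq4 norm_scaleR abs_numeral)
    qed
    ultimately have "r * (3/4 * norm f) \<le> norm (blinfun_apply f (x0 + v)) \<or> r * (3/4 * norm f) \<le> norm (blinfun_apply f (x0 - v))"
      by (auto simp: algebra_simps)
    moreover have "norm ((x0 + v) - x0) \<le> r" "norm ((x0 - v) - x0) \<le> r" using v by simp_all
    ultimately show ?thesis by blast
  qed
  have Tpos: "0 < norm (T n)" for n using T(2)[of n] by (smt (verit) zero_less_power)
  \<comment> \<open>The steps after the \<open>n\<close>-th add up to at most half of
    \<open>1 / 3 ^ n\<close>. They cost at most \<open>norm (T n) / 3 ^ n / 2\<close> of the three
    quarters gained; the remaining quarter exceeds \<open>(4 / 3) ^ n / 4\<close>, since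
    \<open>norm (T n) > 4 ^ n\<close>.\<close>
  have "\<exists>x. \<forall>n. True \<and> (norm (x (Suc n) - x n) \<le> 1 / 3 ^ n \<and>
      1 / 3 ^ n * (3/4 * norm (T n)) \<le> norm (blinfun_apply (T n) (x (Suc n))))"
  proof (rule dependent_nat_choice)
    fix x :: 'a and n
    show "\<exists>y. True \<and> (norm (y - x) \<le> 1 / 3 ^ n \<and>
        1 / 3 ^ n * (3/4 * norm (T n)) \<le> norm (blinfun_apply (T n) y))"
      unfolding simp_thms by (rule step) (use Tpos in simp_all)
  qed simp
  then obtain x where x: "\<And>n. norm (x (Suc n) - x n) \<le> 1 / 3 ^ n"
    "\<And>n. 1 / 3 ^ n * (3/4 * norm (T n)) \<le> norm (blinfun_apply (T n) (x (Suc n)))" by blast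
  define d where "d n = x (Suc n) - x n" for n
  have geo: "summable (\<lambda>n. (1 / 3 :: real) ^ n)" by (rule summable_geometric) simp
  have d: "norm (d n) \<le> (1 / 3) ^ n" for n using x(1)[of n] by (simp add: d_def power_one_over)
  have sd: "summable d" by (rule summable_norm_cancel, rule summable_comparison_test'[OF geo]) (use d in simp)
  define z where "z = x 0 + suminf d"
  have tail: "norm (z - x (Suc n)) \<le> 1 / 3 ^ n / 2" for n
  proof -
    have "x (Suc n) = x 0 + sum d {..<Suc n}" unfolding d_def using sum_lessThan_telescope[of x "Suc n"] by simp
    then have "z - x (Suc n) = (\<Sum>k. d (k + Suc n))"
      using suminf_split_initial_segment[OF sd, of "Suc n"] by (simp add: z_def)
    also have "norm \<dots> \<le> (\<Sum>k. (1 / 3) ^ (k + Suc n))"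
    proof (rule norm_suminf_le)
      show "norm (d (k + Suc n)) \<le> (1 / 3) ^ (k + Suc n)" for k by (rule d)
      show "summable (\<lambda>k. (1 / 3 :: real) ^ (k + Suc n))"
        using geo summable_iff_shift[of "\<lambda>k. (1 / 3 :: real) ^ k" "Suc n"] by blast
    qed
    also have "\<dots> = (\<Sum>k. (1 / 3) ^ k) * (1 / 3) ^ Suc n"
      unfolding power_add by (rule suminf_mult2[symmetric, OF geo])
    also have "\<dots> = 1 / 3 ^ n / 2" by (subst suminf_geometric) (simp_all add: power_one_over)
    finally show ?thesis .
  qed
  obtain M where M: "\<And>n. norm (blinfun_apply (T n) z) \<le> M"
    using assms[of z] T(1) unfolding bounded_iff by blast
  have low: "(4 / 3) ^ n / 4 \<le> M" for n
  proof -
    have "1 / 3 ^ n * (3/4 * norm (T n)) \<le> norm (blinfun_apply (T n) z) + norm (blinfun_apply (T n) (z - x (Suc n)))"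
      using x(2)[of n] norm_triangle_ineq4[of "blinfun_apply (T n) z" "blinfun_apply (T n) (z - x (Suc n))"]
      by (simp add: blinfun.diff_right)
    also have "norm (blinfun_apply (T n) (z - x (Suc n))) \<le> norm (T n) * (1 / 3 ^ n / 2)"
      using norm_blinfun[of "T n" "z - x (Suc n)"] mult_left_mono[OF tail[of n], of "norm (T n)"] by simp
    finally have "norm (T n) / 3 ^ n / 4 \<le> norm (blinfun_apply (T n) z)" by (simp add: field_simps)
    then have "norm (T n) / 3 ^ n / 4 \<le> M" using M[of n] by (rule order_trans)
    moreover have "4 ^ n / 3 ^ n / 4 \<le> norm (T n) / 3 ^ n / 4"
      using T(2)[of n] by (intro divide_right_mono) auto
    ultimately show ?thesis by (simp add: power_divide)
  qed
  obtain n where "4 * M < (4 / 3) ^ n" using real_arch_pow[of "4 / 3" "4 * M"] by auto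
  with low[of n] show False by simp
qed

section \<open>The weak topology and relatively weakly compact sets\<close>

lemma topspace_weak_topology [simp]: "topspace weak_topology = UNIV"
proof -
  have "UNIV \<in> {{x::'a. blinfun_apply f x \<in> U} | (f :: 'a \<Rightarrow>\<^sub>L real) U. open U}"
    by (rule CollectI, intro exI[of _ 0] exI[of _ UNIV]) simp
  then show ?thesis unfolding weak_topology_def topology_generated_by_topspace by blast
qed

lemma openin_weak_preimage:
  fixes f :: "'a::real_normed_vector \<Rightarrow>\<^sub>L real"
  assumes "open U" shows "openin weak_topology {x. blinfun_apply f x \<in> U}"
  unfolding weak_topology_def by (rule topology_generated_by_Basis) (use assms in blast)

definition weak_ball :: "('a::real_normed_vector \<Rightarrow>\<^sub>L real) set \<Rightarrow> 'a \<Rightarrow> real \<Rightarrow> 'a set" where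
  "weak_ball F x e = {y. \<forall>f\<in>F. \<bar>blinfun_apply f y - blinfun_apply f x\<bar> < e}"

lemma openin_weak_ball:
  assumes "finite F" shows "openin weak_topology (weak_ball F x e)"
  using assms
proof (induction F)
  case empty
  then show ?case by (simp add: weak_ball_def openin_topspace[of weak_topology, simplified])
next
  case (insert f F)
  have "weak_ball (insert f F) x e = {y. blinfun_apply f y \<in> ball (blinfun_apply f x) e} \<inter> weak_ball F x e"
    by (auto simp: weak_ball_def dist_real_def abs_minus_commute)
  then show ?case using insert by (simp add: openin_Int openin_weak_preimage del: mem_ball)
qed

lemma weak_ball_subset_open:
  assumes "openin weak_topology U" "x \<in> U"
  obtains F e where "finite F" "0 < e" "weak_ball F x e \<subseteq> U"
proof -
  have "generate_topology_on {{x::'a. blinfun_apply f x \<in> U} | (f :: 'a \<Rightarrow>\<^sub>L real) U. open U} U"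
    using assms(1) by (simp add: weak_topology_def openin_topology_generated_by_iff)
  then have "\<exists>F e. finite F \<and> 0 < e \<and> weak_ball F x e \<subseteq> U" using assms(2)
  proof (induction arbitrary: x rule: generate_topology_on.induct)
    case Empty then show ?case by simp
  next
    case (Int a b)
    then obtain F e G d where "finite F" "0 < e" "weak_ball F x e \<subseteq> a" "finite G" "0 < d" "weak_ball G x d \<subseteq> b"
      by (metis IntD1 IntD2)
    then have "finite (F \<union> G) \<and> 0 < min e d \<and> weak_ball (F \<union> G) x (min e d) \<subseteq> a \<inter> b"
      by (auto simp: weak_ball_def)
    then show ?case by blast
  next
    case (UN K)
    then show ?case by (meson UnionE Union_upper order_trans)
  next
    case (Basis s)
    then obtain f :: "'a \<Rightarrow>\<^sub>L real" and V where s: "s = {x. blinfun_apply f x \<in> V}" "open V" by blast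
    then obtain e where "0 < e" "ball (blinfun_apply f x) e \<subseteq> V" using Basis by (auto simp: open_contains_ball)
    then have "finite {f} \<and> 0 < e \<and> weak_ball {f} x e \<subseteq> s"
      by (auto simp: weak_ball_def s dist_real_def abs_minus_commute subset_iff)
    then show ?case by blast
  qed
  then show thesis using that by blast
qed

lemma Hausdorff_weak_topology: "Hausdorff_space (weak_topology :: 'a::real_normed_vector topology)"
  unfolding Hausdorff_space_def
proof (intro allI impI)
  fix x y :: 'a assume "x \<in> topspace weak_topology \<and> y \<in> topspace weak_topology \<and> x \<noteq> y"
  obtain f :: "'a \<Rightarrow>\<^sub>L real" where f: "blinfun_apply f (x - y) = norm (x - y)" using norming_functional by blast
  define c where "c = (blinfun_apply f x + blinfun_apply f y) / 2"
  have "blinfun_apply f x > blinfun_apply f y"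
  proof -
    have "x \<noteq> y" using \<open>_ \<and> _ \<and> x \<noteq> y\<close> by blast
    then have "0 < norm (x - y)" by simp
    then show ?thesis using f[unfolded blinfun.diff_right] by linarith
  qed
  then have "x \<in> {z. blinfun_apply f z \<in> {c<..}}" "y \<in> {z. blinfun_apply f z \<in> {..<c}}"
    by (auto simp: c_def)
  moreover have "disjnt {z. blinfun_apply f z \<in> {c<..}} {z. blinfun_apply f z \<in> {..<c}}"
    by (auto simp: disjnt_def)
  ultimately show "\<exists>U V. openin weak_topology U \<and> openin weak_topology V \<and> x \<in> U \<and> y \<in> V \<and> disjnt U V"
    using openin_weak_preimage[OF open_greaterThan, of f c] openin_weak_preimage[OF open_lessThan, of f c] by blast
qed

text \<open>A sequence together with its limit is compact, and the Hausdorff property makes this set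
  closed, so it contains the weak closure of the range.\<close>

lemma weakly_null_rel_weakly_compact:
  fixes x :: "nat \<Rightarrow> 'a::real_normed_vector"
  assumes "weakly_null x" shows "rel_weakly_compact (range x)"
proof -
  have K: "compactin weak_topology (insert 0 (range x))" unfolding compactin_def
  proof (intro conjI allI impI)
    fix \<U> assume \<U>: "(\<forall>U\<in>\<U>. openin weak_topology U) \<and> insert 0 (range x) \<subseteq> \<Union>\<U>"
    then obtain U where U: "U \<in> \<U>" "0 \<in> U" by blast
    with \<U> obtain F e where F: "finite F" "0 < e" "weak_ball F 0 e \<subseteq> U" using weak_ball_subset_open by metis
    have "eventually (\<lambda>n. \<forall>f\<in>F. \<bar>blinfun_apply f (x n)\<bar> < e) sequentially"
      using F(1)
    proof (rule eventually_ball_finite)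
      show "\<forall>f\<in>F. eventually (\<lambda>n. \<bar>blinfun_apply f (x n)\<bar> < e) sequentially"
        using assms tendstoD[of _ "0::real" sequentially e] F(2) by (fastforce simp: weakly_null_def)
    qed
    then obtain N where N: "\<And>n. N \<le> n \<Longrightarrow> x n \<in> U"
      using F(3) by (auto simp: eventually_sequentially weak_ball_def subset_iff)
    have "\<forall>n. \<exists>V\<in>\<U>. x n \<in> V" using \<U> by blast
    then obtain V where V: "\<And>n. V n \<in> \<U>" "\<And>n. x n \<in> V n" by metis
    have "x n \<in> \<Union>(insert U (V ` {..<N}))" for n
      using N[of n] V(2)[of n] by (cases "N \<le> n") auto
    then have "finite (insert U (V ` {..<N})) \<and> insert U (V ` {..<N}) \<subseteq> \<U> \<and> insert 0 (range x) \<subseteq> \<Union>(insert U (V ` {..<N}))"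
      using U V(1) by blast
    then show "\<exists>\<F>. finite \<F> \<and> \<F> \<subseteq> \<U> \<and> insert 0 (range x) \<subseteq> \<Union>\<F>" by blast
  qed simp
  then have "closedin weak_topology (insert 0 (range x))"
    by (rule compactin_imp_closedin[OF Hausdorff_weak_topology])
  then have "weak_topology closure_of range x \<subseteq> insert 0 (range x)"
    by (intro closure_of_minimal) auto
  then show ?thesis unfolding rel_weakly_compact_def
    by (rule closed_compactin[OF K]) simp
qed

text \<open>Otherwise every point has a weak ball that the sequence leaves for good. Finitely many
  of these balls cover the closure of \<open>A\<close>, and beyond the largest of their indices the
  sequence has no place left.\<close>

lemma rel_weakly_compact_cluster_point:
  fixes y :: "nat \<Rightarrow> 'a::real_normed_vector"
  assumes "rel_weakly_compact A" "\<And>n. y n \<in> A"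
  obtains z where "\<And>F e N. finite F \<Longrightarrow> 0 < e \<Longrightarrow> \<exists>n\<ge>N. y n \<in> weak_ball F z e"
proof (rule ccontr)
  assume "\<not> thesis"
  have "\<exists>F e N. finite F \<and> 0 < e \<and> (\<forall>n\<ge>N. y n \<notin> weak_ball F z e)" for z
  proof (rule ccontr)
    assume "\<not> ?thesis"
    then have "\<exists>n\<ge>N. y n \<in> weak_ball F z e" if "finite F" "0 < e" for F e N using that by blast
    from that[OF this] \<open>\<not> thesis\<close> show False by blast
  qed
  then have "\<forall>z. \<exists>F e N. finite F \<and> 0 < e \<and> (\<forall>n\<ge>N. y n \<notin> weak_ball F z e)" by blast
  from this[THEN choice] obtain F where "\<forall>z. \<exists>e N. finite (F z) \<and> 0 < e \<and> (\<forall>n\<ge>N. y n \<notin> weak_ball (F z) z e)" ..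
  from this[THEN choice] obtain e where "\<forall>z. \<exists>N. finite (F z) \<and> 0 < e z \<and> (\<forall>n\<ge>N. y n \<notin> weak_ball (F z) z (e z))" ..
  from this[THEN choice] obtain N where "\<forall>z. finite (F z) \<and> 0 < e z \<and> (\<forall>n\<ge>N z. y n \<notin> weak_ball (F z) z (e z))" ..
  then have F: "\<And>z. finite (F z)" "\<And>z. 0 < e z" "\<And>z n. N z \<le> n \<Longrightarrow> y n \<notin> weak_ball (F z) z (e z)"
    by blast+
  let ?K = "weak_topology closure_of A"
  have cov: "?K \<subseteq> \<Union>((\<lambda>z. weak_ball (F z) z (e z)) ` UNIV)"
  proof
    fix z show "z \<in> \<Union>((\<lambda>z. weak_ball (F z) z (e z)) ` UNIV)"
      by (rule UnionI[OF rangeI[of _ z]]) (simp add: weak_ball_def F(2))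
  qed
  have "\<exists>\<F>. finite \<F> \<and> \<F> \<subseteq> (\<lambda>z. weak_ball (F z) z (e z)) ` UNIV \<and> ?K \<subseteq> \<Union>\<F>"
    by (rule compactinD[OF assms(1)[unfolded rel_weakly_compact_def] _ cov]) (use openin_weak_ball[OF F(1)] in auto)
  then obtain \<F> where \<F>: "finite \<F>" "\<F> \<subseteq> (\<lambda>z. weak_ball (F z) z (e z)) ` UNIV" "?K \<subseteq> \<Union>\<F>" by blast
  from finite_subset_image[OF \<F>(1,2)]
  obtain Z where Z: "finite Z" "?K \<subseteq> (\<Union>z\<in>Z. weak_ball (F z) z (e z))" using \<F>(3) by auto
  define M where "M = Max (insert 0 (N ` Z))"
  have "y M \<in> ?K" using assms(2) closure_of_subset[of A weak_topology] by auto
  then obtain z where "z \<in> Z" "y M \<in> weak_ball (F z) z (e z)" using Z(2) by blast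
  moreover have "N z \<le> M" unfolding M_def using Z(1) \<open>z \<in> Z\<close> by (intro Max_ge) auto
  ultimately show False using F(3) by blast
qed

definition eval_at :: "'a::real_normed_vector \<Rightarrow> ('a \<Rightarrow>\<^sub>L real) \<Rightarrow>\<^sub>L real" where
  "eval_at y = Blinfun (\<lambda>f. blinfun_apply f y)"

lemma eval_at_apply: "blinfun_apply (eval_at y) f = blinfun_apply f y"
  unfolding eval_at_def by (simp add: bounded_linear_Blinfun_apply blinfun.bounded_linear_left)

text \<open>Cluster points show that each functional is bounded on \<open>A\<close>. Uniform
  boundedness is then applied to evaluations on the dual, which is complete even if the space is
  not; norming functionals recover the norm of the vector.\<close>

lemma rel_weakly_compact_bounded:
  fixes A :: "'a::real_normed_vector set"
  assumes "rel_weakly_compact A" shows "bounded A"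
proof -
  have f: "bounded (blinfun_apply f ` A)" for f :: "'a \<Rightarrow>\<^sub>L real"
  proof (rule ccontr)
    assume "\<not> bounded (blinfun_apply f ` A)"
    then have "\<exists>y\<in>A. real n < \<bar>blinfun_apply f y\<bar>" for n by (auto simp: bounded_iff not_le)
    then obtain y where y: "\<And>n. y n \<in> A" "\<And>n. real n < \<bar>blinfun_apply f (y n)\<bar>" by metis
    obtain z where z: "\<And>F e N. finite F \<Longrightarrow> 0 < e \<Longrightarrow> \<exists>n\<ge>N. y n \<in> weak_ball F z e"
      using rel_weakly_compact_cluster_point[of A y] assms y(1) by blast
    obtain N :: nat where N: "\<bar>blinfun_apply f z\<bar> + 1 < real N" using reals_Archimedean2 by blast
    obtain n where "N \<le> n" "\<bar>blinfun_apply f (y n) - blinfun_apply f z\<bar> < 1"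
      using z[of "{f}" 1 N] by (auto simp: weak_ball_def)
    then show False using y(2)[of n] N by linarith
  qed
  have "bounded (eval_at ` A)"
    by (rule uniform_boundedness) (use f in \<open>simp add: image_image eval_at_apply\<close>)
  then obtain M where M: "\<And>y. y \<in> A \<Longrightarrow> norm (eval_at y) \<le> M" by (auto simp: bounded_iff)
  have "norm y \<le> norm (eval_at y)" for y :: 'a
  proof -
    obtain f :: "'a \<Rightarrow>\<^sub>L real" where f: "norm f \<le> 1" "blinfun_apply f y = norm y" using norming_functional by blast
    have "norm y \<le> norm (eval_at y) * norm f" using norm_blinfun[of "eval_at y" f] by (simp add: eval_at_apply f)
    also have "\<dots> \<le> norm (eval_at y)" using f(1) by (simp add: mult_left_le)
    finally show ?thesis .
  qed
  then show ?thesis using M unfolding bounded_iff by (meson order_trans)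
qed

section \<open>Disjoint sequences in solid hulls\<close>

text \<open>The gliding hump behind the Schur property of \<open>\<ell>\<^sup>1\<close>, for the operator
  \<open>y \<mapsto> (g i y)\<^sub>i\<close>. The \<open>k\<close>-th hump is chosen so close to the cluster point \<open>z\<close> on the
  coordinates before it that every cluster point of the humps has the same coordinates as \<open>z\<close>;
  this replaces the passage to weakly convergent subsequences.\<close>

lemma rel_weakly_compact_uniform_null:
  fixes g :: "nat \<Rightarrow> 'a::real_normed_vector \<Rightarrow>\<^sub>L real"
  assumes W: "rel_weakly_compact W"
    and C: "\<And>y N. (\<Sum>i<N. \<bar>blinfun_apply (g i) y\<bar>) \<le> C * norm y"
    and e: "0 < e"
  shows "eventually (\<lambda>n. \<forall>y\<in>W. \<bar>blinfun_apply (g n) y\<bar> \<le> e) sequentially"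
proof (rule ccontr)
  assume "\<not> ?thesis"
  then have "\<forall>N. \<exists>n\<ge>N. \<exists>y\<in>W. e < \<bar>blinfun_apply (g n) y\<bar>"
    by (auto simp: eventually_sequentially not_le)
  then have "\<forall>N. \<exists>n y. N \<le> n \<and> y \<in> W \<and> e < \<bar>blinfun_apply (g n) y\<bar>" by blast
  from this[THEN choice] obtain m where "\<forall>N. \<exists>y. N \<le> m N \<and> y \<in> W \<and> e < \<bar>blinfun_apply (g (m N)) y\<bar>" ..
  from this[THEN choice] obtain y where "\<forall>N. N \<le> m N \<and> y N \<in> W \<and> e < \<bar>blinfun_apply (g (m N)) (y N)\<bar>" ..
  then have m: "\<And>N. N \<le> m N" and yW: "\<And>N. y N \<in> W" and y: "\<And>N. e < \<bar>blinfun_apply (g (m N)) (y N)\<bar>"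
    by blast+
  have sabs: "summable (\<lambda>i. \<bar>blinfun_apply (g i) v\<bar>)" for v
  proof (rule bounded_imp_summable)
    show "(\<Sum>i\<le>n. \<bar>blinfun_apply (g i) v\<bar>) \<le> C * norm v" for n
      using C[where N="Suc n" and y=v] by (simp add: lessThan_Suc_atMost)
  qed simp
  obtain z where z: "\<And>F e N. finite F \<Longrightarrow> 0 < e \<Longrightarrow> \<exists>n\<ge>N. y n \<in> weak_ball F z e"
    using rel_weakly_compact_cluster_point[of W y] W yW by blast
  have "(\<lambda>i. \<bar>blinfun_apply (g i) z\<bar>) \<longlonglongrightarrow> 0" by (rule summable_LIMSEQ_zero[OF sabs])
  then have "eventually (\<lambda>i. \<bar>blinfun_apply (g i) z\<bar> < e / 2) sequentially"
    using e by (intro order_tendstoD(2)) auto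
  then obtain P0 where P0: "\<And>i. P0 \<le> i \<Longrightarrow> \<bar>blinfun_apply (g i) z\<bar> < e / 2"
    by (auto simp: eventually_sequentially)
  \<comment> \<open>At the large coordinate \<open>h k - z\<close> exceeds \<open>e / 2\<close>; the
    coordinates before and after the block lose at most \<open>\<delta>\<close> each, which leaves
    \<open>e / 4\<close>.\<close>
  define \<delta> where "\<delta> = e / 8"
  have \<delta>: "0 < \<delta>" using e by (simp add: \<delta>_def)
  \<comment> \<open>The \<open>k\<close>-th block is \<open>{p..<p'}\<close>. In the closeness to
    \<open>z\<close>, the factor \<open>Suc p\<close> keeps the sum over the \<open>p\<close>
    earlier coordinates below \<open>\<delta>\<close>, and the factor \<open>Suc k\<close> makes
    each coordinate converge to that of \<open>z\<close>.\<close>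
  define R where "R k p N p' \<longleftrightarrow> p \<le> m N \<and> m N < p' \<and> y N \<in> weak_ball (g ` {..<p}) z (\<delta> / (real (Suc k) * real (Suc p)))
      \<and> (\<Sum>i. \<bar>blinfun_apply (g (i + p')) (y N - z)\<bar>) < \<delta>" for k p N p'
  have "\<exists>s. \<forall>k. P0 \<le> snd (s k) \<and> R k (snd (s k)) (fst (s (Suc k))) (snd (s (Suc k)))"
  proof (rule dependent_nat_choice)
    show "\<exists>s :: nat \<times> nat. P0 \<le> snd s" by (intro exI[of _ "(0, P0)"]) simp
    fix s :: "nat \<times> nat" and k assume s: "P0 \<le> snd s"
    let ?p = "snd s"
    obtain N where N: "?p \<le> N" "y N \<in> weak_ball (g ` {..<?p}) z (\<delta> / (real (Suc k) * real (Suc ?p)))"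
      using z[of "g ` {..<?p}" "\<delta> / (real (Suc k) * real (Suc ?p))" ?p] \<delta> by auto
    obtain q where q: "\<And>n. q \<le> n \<Longrightarrow> norm (\<Sum>i. \<bar>blinfun_apply (g (i + n)) (y N - z)\<bar>) < \<delta>"
      using suminf_exist_split[OF \<delta> sabs, of "y N - z"] by blast
    define p' where "p' = max q (Suc (m N))"
    have "R k ?p N p'" unfolding R_def
      using N order_trans[OF N(1) m] q[of p'] by (auto simp: p'_def)
    moreover from this have "P0 \<le> p'" using s by (simp add: R_def)
    ultimately show "\<exists>s'. P0 \<le> snd s' \<and> R k (snd s) (fst s') (snd s')"
      by (intro exI[of _ "(N, p')"]) simp
  qed
  then obtain s where s: "\<And>k. P0 \<le> snd (s k)" "\<And>k. R k (snd (s k)) (fst (s (Suc k))) (snd (s (Suc k)))" by blast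
  define p where "p k = snd (s k)" for k
  define h where "h k = y (fst (s (Suc k)))" for k
  define M where "M k = m (fst (s (Suc k)))" for k
  have pM: "p k \<le> M k" "M k < p (Suc k)" and P0M: "P0 \<le> M k"
    and near: "h k \<in> weak_ball (g ` {..<p k}) z (\<delta> / (real (Suc k) * real (Suc (p k))))"
    and tail: "(\<Sum>i. \<bar>blinfun_apply (g (i + p (Suc k))) (h k - z)\<bar>) < \<delta>"
    and big: "e < \<bar>blinfun_apply (g (M k)) (h k)\<bar>" for k
    using s(2)[of k] s(1)[of k] y by (auto simp: R_def p_def h_def M_def)
  have mono: "strict_mono p" using pM by (intro strict_monoI_Suc) (rule le_less_trans)
  have kp: "k \<le> p k" for k using mono by (rule strict_mono_imp_increasing)
  \<comment> \<open>The number of the block that contains \<open>i\<close>. Indices before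
    \<open>p 0\<close> get block 0, which is harmless: off the \<open>k\<close>-th block,
    \<open>hump\<close> needs only that the signs have modulus at most 1.\<close>
  define blk where "blk i = (LEAST k. i < p (Suc k))" for i
  have blk: "blk i = k" if "p k \<le> i" "i < p (Suc k)" for i k
    unfolding blk_def
  proof (rule Least_equality)
    fix j assume "i < p (Suc j)"
    show "k \<le> j"
    proof (rule ccontr)
      assume "\<not> k \<le> j"
      then have "p (Suc j) \<le> p k" using mono by (simp add: strict_mono_less_eq)
      then show False using that(1) \<open>i < p (Suc j)\<close> by simp
    qed
  qed (rule that(2))
  \<comment> \<open>Copying the signs of \<open>h k - z\<close> on block \<open>k\<close> gives one
    functional that sees every hump with its full size.\<close>
  define \<theta> where "\<theta> i = sgn (blinfun_apply (g i) (h (blk i) - z))" for i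
  have \<theta>1: "\<bar>\<theta> i * t\<bar> \<le> \<bar>t\<bar>" for i and t :: real
    by (simp add: \<theta>_def abs_mult sgn_if)
  have sm: "summable (\<lambda>i. \<theta> i * blinfun_apply (g i) v)" for v
    by (rule summable_rabs_cancel, rule summable_comparison_test'[OF sabs[of v]]) (use \<theta>1 in auto)
  define \<phi> where "\<phi> = Blinfun (\<lambda>v. \<Sum>i. \<theta> i * blinfun_apply (g i) v)"
  have "bounded_linear (\<lambda>v. \<Sum>i. \<theta> i * blinfun_apply (g i) v)"
  proof (rule bounded_linear_intro)
    fix v w :: 'a and r :: real
    show "(\<Sum>i. \<theta> i * blinfun_apply (g i) (v + w)) = (\<Sum>i. \<theta> i * blinfun_apply (g i) v) + (\<Sum>i. \<theta> i * blinfun_apply (g i) w)"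
      by (simp add: suminf_add[OF sm sm] blinfun.add_right distrib_left)
    show "(\<Sum>i. \<theta> i * blinfun_apply (g i) (r *\<^sub>R v)) = r *\<^sub>R (\<Sum>i. \<theta> i * blinfun_apply (g i) v)"
      using suminf_mult[OF sm, of r v] by (simp add: blinfun.scaleR_right mult.left_commute)
    have "norm (\<Sum>i. \<theta> i * blinfun_apply (g i) v) \<le> (\<Sum>i. \<bar>blinfun_apply (g i) v\<bar>)"
      by (rule norm_suminf_le) (use \<theta>1 sabs in auto)
    also have "\<dots> \<le> C * norm v" by (rule suminf_le_const[OF sabs C])
    finally show "norm (\<Sum>i. \<theta> i * blinfun_apply (g i) v) \<le> norm v * C" by (simp add: mult.commute)
  qed
  then have \<phi>: "blinfun_apply \<phi> v = (\<Sum>i. \<theta> i * blinfun_apply (g i) v)" for v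
    by (simp add: \<phi>_def bounded_linear_Blinfun_apply)
  have hump: "e / 4 \<le> blinfun_apply \<phi> (h k - z)" for k
  proof -
    let ?a = "\<lambda>i. blinfun_apply (g i) (h k - z)"
    have "blinfun_apply \<phi> (h k - z) = (\<Sum>i. \<theta> (i + p (Suc k)) * ?a (i + p (Suc k))) + (\<Sum>i<p (Suc k). \<theta> i * ?a i)"
      unfolding \<phi> by (rule suminf_split_initial_segment[OF sm])
    also have "(\<Sum>i<p (Suc k). \<theta> i * ?a i) = (\<Sum>i<p k. \<theta> i * ?a i) + (\<Sum>i=p k..<p (Suc k). \<theta> i * ?a i)"
    proof -
      have "p k \<le> p (Suc k)" using pM[of k] by simp
      then show ?thesis
        using sum.atLeastLessThan_concat[of 0 "p k" "p (Suc k)" "\<lambda>i. \<theta> i * ?a i"]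
        by (simp add: lessThan_atLeast0)
    qed
    also have "(\<Sum>i=p k..<p (Suc k). \<theta> i * ?a i) = (\<Sum>i=p k..<p (Suc k). \<bar>?a i\<bar>)"
      by (rule sum.cong) (auto simp: \<theta>_def blk sgn_if)
    finally have eq: "blinfun_apply \<phi> (h k - z) = (\<Sum>i. \<theta> (i + p (Suc k)) * ?a (i + p (Suc k)))
        + ((\<Sum>i<p k. \<theta> i * ?a i) + (\<Sum>i=p k..<p (Suc k). \<bar>?a i\<bar>))" .
    have "\<bar>\<Sum>i. \<theta> (i + p (Suc k)) * ?a (i + p (Suc k))\<bar> \<le> (\<Sum>i. \<bar>?a (i + p (Suc k))\<bar>)"
      using sabs[of "h k - z"] \<theta>1 summable_iff_shift[of "\<lambda>i. \<bar>?a i\<bar>" "p (Suc k)"]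
      by (intro norm_suminf_le[where 'a = real, unfolded real_norm_def]) auto
    then have t: "- \<delta> \<le> (\<Sum>i. \<theta> (i + p (Suc k)) * ?a (i + p (Suc k)))" using tail[of k] by linarith
    have "\<bar>\<Sum>i<p k. \<theta> i * ?a i\<bar> \<le> (\<Sum>i<p k. \<bar>?a i\<bar>)"
      by (rule order_trans[OF sum_abs sum_mono]) (rule \<theta>1)
    also have "\<dots> \<le> (\<Sum>i<p k. \<delta> / (real (Suc k) * real (Suc (p k))))"
    proof (rule sum_mono)
      fix i assume "i \<in> {..<p k}"
      then show "\<bar>?a i\<bar> \<le> \<delta> / (real (Suc k) * real (Suc (p k)))"
        using near[of k] by (auto simp: weak_ball_def blinfun.diff_right less_imp_le)
    qed
    also have "\<dots> \<le> \<delta>"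
    proof -
      have "real (p k) * \<delta> \<le> \<delta> * (real (Suc k) * real (Suc (p k)))"
        using \<delta> mult_mono[of 1 "real (Suc k)" "real (p k)" "real (Suc (p k))"] by (simp add: mult.commute)
      then show ?thesis by (simp add: divide_le_eq)
    qed
    finally have i: "- \<delta> \<le> (\<Sum>i<p k. \<theta> i * ?a i)" by linarith
    have "e / 2 < \<bar>?a (M k)\<bar>" using big[of k] P0[OF P0M[of k]] unfolding blinfun.diff_right by linarith
    also have "\<dots> \<le> (\<Sum>i=p k..<p (Suc k). \<bar>?a i\<bar>)"
      by (rule member_le_sum) (use pM[of k] in auto)
    finally show ?thesis using eq t i by (simp add: \<delta>_def)
  qed
  obtain z' where z': "\<And>F e N. finite F \<Longrightarrow> 0 < e \<Longrightarrow> \<exists>k\<ge>N. h k \<in> weak_ball F z' e"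
    using rel_weakly_compact_cluster_point[of W h] W yW by (auto simp: h_def)
  \<comment> \<open>\<open>\<phi>\<close> depends only on the coordinates \<open>g i\<close>. If
    they agree at \<open>z'\<close> and \<open>z\<close>, so does \<open>\<phi>\<close>, whereas
    \<open>hump\<close> keeps its values at \<open>h k\<close> at least \<open>e / 4\<close> above
    its value at \<open>z\<close>.\<close>
  have "blinfun_apply (g i) (z' - z) = 0" for i
  proof (rule ccontr)
    define \<eta> where "\<eta> = \<bar>blinfun_apply (g i) (z' - z)\<bar> / 2"
    assume "blinfun_apply (g i) (z' - z) \<noteq> 0"
    then have \<eta>: "0 < \<eta>" by (simp add: \<eta>_def)
    obtain K :: nat where K: "\<delta> / \<eta> < real K" using reals_Archimedean2 by blast
    obtain k where k: "max K (Suc i) \<le> k" "h k \<in> weak_ball {g i} z' \<eta>" using z'[of "{g i}" \<eta>] \<eta> by blast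
    have "i < p k" using k(1) kp[of k] by simp
    then have "\<bar>blinfun_apply (g i) (h k) - blinfun_apply (g i) z\<bar> < \<delta> / (real (Suc k) * real (Suc (p k)))"
      using near[of k] by (auto simp: weak_ball_def)
    also have "\<dots> \<le> \<delta> / real (Suc k)"
      using \<delta> by (intro divide_left_mono) auto
    also have "\<dots> < \<eta>"
    proof -
      have "\<delta> < \<eta> * real K" using K \<eta> by (simp add: divide_less_eq mult.commute)
      also have "\<dots> \<le> \<eta> * real (Suc k)" using k(1) \<eta> by (intro mult_left_mono) auto
      finally show ?thesis by (simp add: divide_less_eq)
    qed
    finally have "\<bar>blinfun_apply (g i) (h k) - blinfun_apply (g i) z\<bar> < \<eta>" .
    moreover have "\<bar>blinfun_apply (g i) (h k) - blinfun_apply (g i) z'\<bar> < \<eta>"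
      using k(2) by (simp add: weak_ball_def)
    ultimately have "\<bar>blinfun_apply (g i) z' - blinfun_apply (g i) z\<bar> < 2 * \<eta>" by linarith
    then show False by (simp add: \<eta>_def blinfun.diff_right)
  qed
  then have "blinfun_apply \<phi> (z' - z) = 0" by (simp add: \<phi>)
  moreover obtain k where "\<bar>blinfun_apply \<phi> (h k) - blinfun_apply \<phi> z'\<bar> < e / 4"
    using z'[of "{\<phi>}" "e / 4" 0] e by (auto simp: weak_ball_def)
  ultimately show False using hump[of k] unfolding blinfun.diff_right by linarith
qed

text \<open>Up to an error \<open>e / real (Suc N)\<close> each, the components are values of
  \<open>f\<close> at the disjoint elements \<open>inf z (t i *\<^sub>R u i)\<close> below
  \<open>z\<close>, whose sum is still below \<open>z\<close>.\<close>

lemma sum_dual_components_le: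
  fixes f :: "'a::banach_lattice \<Rightarrow>\<^sub>L real" and u :: "nat \<Rightarrow> 'a"
  assumes f: "0 \<le> f" and u: "\<And>i j. i \<noteq> j \<Longrightarrow> inf (u i) (u j) = 0" "\<And>i. 0 \<le> u i"
    and c: "\<And>i z e. 0 \<le> z \<Longrightarrow> 0 < e \<Longrightarrow> \<exists>t\<ge>0. blinfun_apply (c i) z < blinfun_apply f (inf z (t *\<^sub>R u i)) + e"
    and z: "0 \<le> z"
  shows "(\<Sum>i<N. blinfun_apply (c i) z) \<le> blinfun_apply f z"
proof (rule field_le_epsilon)
  fix e :: real assume e: "0 < e"
  have "\<exists>t\<ge>0. blinfun_apply (c i) z < blinfun_apply f (inf z (t *\<^sub>R u i)) + e / real (Suc N)" for i
    using c[OF z, of "e / real (Suc N)"] e by simp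
  then obtain t where t: "\<And>i. 0 \<le> t i" "\<And>i. blinfun_apply (c i) z < blinfun_apply f (inf z (t i *\<^sub>R u i)) + e / real (Suc N)"
    by metis
  have tu: "0 \<le> t i *\<^sub>R u i" for i using t(1) u(2) by (rule scaleR_nonneg_nonneg)
  have dis: "inf (t i *\<^sub>R u i) (t j *\<^sub>R u j) = 0" if "i \<noteq> j" for i j
    using disjoint_scaleR[OF disjoint_scaleR[OF u(1)[OF that] t(1)[of j], unfolded inf_commute[of "u i"]] t(1)[of i]]
    by (simp only: inf_commute)
  have "(\<Sum>i<N. inf z (t i *\<^sub>R u i)) \<le> z"
  proof (rule sum_disjoint_le)
    fix i j :: nat assume "i \<noteq> j"
    show "inf (inf z (t i *\<^sub>R u i)) (inf z (t j *\<^sub>R u j)) = 0"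
      by (rule disjoint_mono[OF dis[OF \<open>i \<noteq> j\<close>]]) (use z tu in auto)
  qed (use z tu in auto)
  from dual_nonneg_mono[OF f this]
  have le: "(\<Sum>i<N. blinfun_apply f (inf z (t i *\<^sub>R u i))) \<le> blinfun_apply f z"
    by (simp add: blinfun.sum_right)
  have "(\<Sum>i<N. blinfun_apply (c i) z) \<le> (\<Sum>i<N. blinfun_apply f (inf z (t i *\<^sub>R u i)) + e / real (Suc N))"
    by (rule sum_mono) (use t(2) less_imp_le in blast)
  also have "\<dots> \<le> blinfun_apply f z + real N * (e / real (Suc N))"
    using le by (simp add: sum.distrib)
  also have "\<dots> \<le> blinfun_apply f z + e" using e by (simp add: field_simps)
  finally show "(\<Sum>i<N. blinfun_apply (c i) z) \<le> blinfun_apply f z + e" .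
qed

lemma disjoint_seq_sol_weakly_null:
  fixes x :: "nat \<Rightarrow> 'a::banach_lattice"
  assumes W: "rel_weakly_compact W" and x: "disjoint_seq x" "\<And>n. x n \<in> sol W"
  shows "weakly_null x"
  unfolding weakly_null_def
proof
  fix f :: "'a \<Rightarrow>\<^sub>L real"
  define F where "F = lmod f"
  have F: "0 \<le> F" by (simp add: F_def)
  have "\<forall>n. \<exists>y\<in>W. lmod (x n) \<le> lmod y" using x(2) by (simp add: sol_def)
  then obtain y where y: "\<And>n. y n \<in> W" "\<And>n. lmod (x n) \<le> lmod (y n)" by metis
  have "\<forall>n. \<exists>c. 0 \<le> c \<and> blinfun_apply c (lmod (x n)) = blinfun_apply F (lmod (x n)) \<and>
      (\<forall>z e. 0 \<le> z \<longrightarrow> 0 < e \<longrightarrow> (\<exists>t\<ge>0. blinfun_apply c z < blinfun_apply F (inf z (t *\<^sub>R lmod (x n))) + e))"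
  proof
    fix n show "\<exists>c. 0 \<le> c \<and> blinfun_apply c (lmod (x n)) = blinfun_apply F (lmod (x n)) \<and>
      (\<forall>z e. 0 \<le> z \<longrightarrow> 0 < e \<longrightarrow> (\<exists>t\<ge>0. blinfun_apply c z < blinfun_apply F (inf z (t *\<^sub>R lmod (x n))) + e))"
      by (rule dual_component[OF F lmod_nonneg[of "x n"]]) blast
  qed
  from this[THEN choice] obtain c where "\<forall>n. 0 \<le> c n \<and> blinfun_apply (c n) (lmod (x n)) = blinfun_apply F (lmod (x n)) \<and>
      (\<forall>z e. 0 \<le> z \<longrightarrow> 0 < e \<longrightarrow> (\<exists>t\<ge>0. blinfun_apply (c n) z < blinfun_apply F (inf z (t *\<^sub>R lmod (x n))) + e))" ..
  then have c: "\<And>n. 0 \<le> c n" "\<And>n. blinfun_apply (c n) (lmod (x n)) = blinfun_apply F (lmod (x n))"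
    "\<And>n z e. 0 \<le> z \<Longrightarrow> 0 < e \<Longrightarrow> \<exists>t\<ge>0. blinfun_apply (c n) z < blinfun_apply F (inf z (t *\<^sub>R lmod (x n))) + e"
    by blast+
  \<comment> \<open>The components are controlled at \<open>lmod (y n)\<close>, but only
    \<open>y n\<close> is known to lie in \<open>W\<close>. Smaller functionals \<open>g n\<close>
    keep the bound on the sums and give at least half of the value at \<open>y n\<close>
    itself.\<close>
  have "\<forall>n. \<exists>g. 0 \<le> g \<and> g \<le> c n \<and> blinfun_apply (c n) (lmod (y n)) \<le> 2 * \<bar>blinfun_apply g (y n)\<bar>"
    using dual_attains_half_lmod[OF c(1)] by metis
  from this[THEN choice] obtain g where g: "\<forall>n. 0 \<le> g n \<and> g n \<le> c n \<and> blinfun_apply (c n) (lmod (y n)) \<le> 2 * \<bar>blinfun_apply (g n) (y n)\<bar>" ..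
  have bound: "(\<Sum>i<N. \<bar>blinfun_apply (g i) v\<bar>) \<le> norm F * norm v" for v N
  proof -
    have "(\<Sum>i<N. \<bar>blinfun_apply (g i) v\<bar>) \<le> (\<Sum>i<N. blinfun_apply (c i) (lmod v))"
    proof (rule sum_mono)
      fix i
      have "\<bar>blinfun_apply (g i) v\<bar> \<le> blinfun_apply (g i) (lmod v)"
        using abs_apply_le[of "g i" v] g by simp
      also have "\<dots> \<le> blinfun_apply (c i) (lmod v)" by (rule dual_leD) (use g in auto)
      finally show "\<bar>blinfun_apply (g i) v\<bar> \<le> blinfun_apply (c i) (lmod v)" .
    qed
    also have "\<dots> \<le> blinfun_apply F (lmod v)"
      by (rule sum_dual_components_le[OF F, of "\<lambda>n. lmod (x n)"]) (use x(1) c(3) in \<open>auto simp: disjoint_seq_def\<close>)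
    also have "\<dots> \<le> norm F * norm (lmod v)"
      using norm_blinfun[of F "lmod v"] by (simp only: real_norm_def)
    finally show ?thesis by simp
  qed
  have le: "\<bar>blinfun_apply f (x n)\<bar> \<le> 2 * \<bar>blinfun_apply (g n) (y n)\<bar>" for n
  proof -
    have "\<bar>blinfun_apply f (x n)\<bar> \<le> blinfun_apply (c n) (lmod (x n))"
      using abs_apply_le[of f "x n"] by (simp add: c(2) F_def)
    also have "\<dots> \<le> blinfun_apply (c n) (lmod (y n))" by (rule dual_nonneg_mono[OF c(1) y(2)])
    finally show ?thesis using g by (meson order_trans)
  qed
  show "(\<lambda>n. blinfun_apply f (x n)) \<longlonglongrightarrow> 0"
  proof (rule LIMSEQ_I)
    fix e :: real assume e: "0 < e"
    have "eventually (\<lambda>n. \<forall>y\<in>W. \<bar>blinfun_apply (g n) y\<bar> \<le> e / 4) sequentially"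
      by (rule rel_weakly_compact_uniform_null[OF W bound]) (use e in simp)
    then obtain N where N: "\<And>n. N \<le> n \<Longrightarrow> \<bar>blinfun_apply (g n) (y n)\<bar> \<le> e / 4"
      using y(1) by (auto simp: eventually_sequentially)
    have "norm (blinfun_apply f (x n) - 0) < e" if "N \<le> n" for n
      using le[of n] N[OF that] e by simp
    then show "\<exists>N. \<forall>n\<ge>N. norm (blinfun_apply f (x n) - 0) < e" by blast
  qed
qed

text \<open>Disjointness is essential: the Rademacher functions in L^2 are weakly null with constant
  modulus. Here the moduli are a disjoint sequence in the solid hull of the range.\<close>

lemma weakly_null_lmod:
  fixes x :: "nat \<Rightarrow> 'a::banach_lattice"
  assumes "disjoint_seq x" "weakly_null x" shows "weakly_null (\<lambda>n. lmod (x n))"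
proof (rule disjoint_seq_sol_weakly_null[OF weakly_null_rel_weakly_compact[OF assms(2)]])
  show "disjoint_seq (\<lambda>n. lmod (x n))" using assms(1) by (simp add: disjoint_seq_def)
  show "lmod (x n) \<in> sol (range x)" for n by (auto simp: sol_def)
qed

text \<open>The sum of the moduli is the supremum of all signed sums. \<open>w\<close> collects the
  images whose sign is already chosen, and the induction treats both signs of the next one; every
  signed sum of \<open>us\<close> is an admissible \<open>y\<close>.\<close>

lemma sum_list_lmod_le:
  fixes T :: "'a::banach_lattice \<Rightarrow>\<^sub>L 'b::banach_lattice"
  assumes "\<forall>u\<in>set us. 0 \<le> u" "\<And>y. lmod y \<le> sum_list us \<Longrightarrow> blinfun_apply T y + w \<le> z"
  shows "sum_list (map (\<lambda>u. lmod (blinfun_apply T u)) us) + w \<le> z"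
  using assms
proof (induction us arbitrary: w)
  case Nil
  then show ?case using Nil.prems(2)[of 0] by simp
next
  case (Cons u us)
  let ?s = "sum_list (map (\<lambda>u. lmod (blinfun_apply T u)) us)"
  have u: "0 \<le> u" using Cons.prems by simp
  have le: "lmod (y + v) \<le> sum_list (u # us)" if "lmod y \<le> sum_list us" "lmod v \<le> u" for y v
    using order_trans[OF lmod_triangle[of y v] add_mono[OF that]] by (simp add: add.commute)
  have "?s + (blinfun_apply T u + w) \<le> z"
  proof (rule Cons.IH)
    fix y assume "lmod y \<le> sum_list us"
    from Cons.prems(2)[OF le[OF this, of u]] u show "blinfun_apply T y + (blinfun_apply T u + w) \<le> z"
      by (simp add: blinfun.add_right add.assoc)
  qed (use Cons.prems in simp)
  moreover have "?s + (- blinfun_apply T u + w) \<le> z"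
  proof (rule Cons.IH)
    fix y assume "lmod y \<le> sum_list us"
    from Cons.prems(2)[OF le[OF this, of "- u"]] u show "blinfun_apply T y + (- blinfun_apply T u + w) \<le> z"
      by (simp add: blinfun.diff_right algebra_simps)
  qed (use Cons.prems in simp)
  ultimately have "lmod (blinfun_apply T u) \<le> z - w - ?s"
    unfolding lmod_le_iff by (simp add: algebra_simps)
  then show ?case by (simp add: algebra_simps)
qed

text \<open>This is the refinement behind subadditivity of the modulus of the adjoint: splitting a
  term can only increase \<open>val\<close>, by the triangle inequality for
  \<open>lmod\<close>.\<close>

lemma riesz_decomposition_list:
  fixes T :: "'a::banach_lattice \<Rightarrow>\<^sub>L 'b::banach_lattice" and g :: "'b \<Rightarrow>\<^sub>L real"
  defines "val \<equiv> \<lambda>us. sum_list (map (\<lambda>u. blinfun_apply g (lmod (blinfun_apply T u))) us)"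
  assumes g: "0 \<le> g" and "\<forall>u\<in>set us. 0 \<le> u" "sum_list us = x + y" "0 \<le> x" "0 \<le> y"
  shows "\<exists>vs ws. (\<forall>v\<in>set vs. 0 \<le> v) \<and> (\<forall>w\<in>set ws. 0 \<le> w) \<and> sum_list vs = x \<and> sum_list ws = y
    \<and> val us \<le> val vs + val ws"
  using assms(3-)
proof (induction us arbitrary: x y)
  case Nil
  then have "x = 0" "y = 0" by (simp_all add: add_nonneg_eq_0_iff)
  then show ?case by (intro exI[of _ "[]"]) (simp add: val_def)
next
  case (Cons u us)
  \<comment> \<open>Greedy choice: \<open>x\<close> takes as much of \<open>u\<close> as it can, and
    the rest \<open>w\<close> is charged to \<open>y\<close>. It fits there because
    \<open>y - w\<close> is the infimum of \<open>y\<close> and the sum of the remaining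
    list.\<close>
  define v where "v = inf u x"
  define w where "w = u - v"
  have u: "0 \<le> u" and us: "0 \<le> sum_list us" using Cons.prems by (auto intro: sum_list_nonneg)
  have "v \<le> u" "v \<le> x" by (simp_all add: v_def)
  then have v: "0 \<le> w" "0 \<le> x - v" by (simp_all add: w_def)
  have v0: "0 \<le> v" using u Cons.prems by (simp add: v_def)
  have "y - w = inf y (x + y - u)"
  proof -
    have "y - w = (y - u) + inf u x" by (simp add: w_def v_def)
    also have "\<dots> = inf y (x + y - u)" by (simp add: add_inf_distrib_left algebra_simps)
    finally show ?thesis .
  qed
  moreover have "x + y - u = sum_list us" using Cons.prems(2) by (simp add: algebra_simps)
  ultimately have yw: "0 \<le> y - w" using us Cons.prems by simp
  have "sum_list us = (x - v) + (y - w)" using Cons.prems(2) by (simp add: w_def algebra_simps)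
  then obtain vs ws where *: "\<forall>v\<in>set vs. 0 \<le> v" "\<forall>w\<in>set ws. 0 \<le> w" "sum_list vs = x - v"
      "sum_list ws = y - w" "val us \<le> val vs + val ws"
    using Cons.IH[of "x - v" "y - w"] Cons.prems v(2) yw by auto
  have "blinfun_apply T u = blinfun_apply T v + blinfun_apply T w" by (simp add: w_def blinfun.diff_right)
  then have "blinfun_apply g (lmod (blinfun_apply T u)) \<le> blinfun_apply g (lmod (blinfun_apply T v)) + blinfun_apply g (lmod (blinfun_apply T w))"
    using dual_nonneg_mono[OF g lmod_triangle[of "blinfun_apply T v" "blinfun_apply T w"]] by (simp add: blinfun.add_right)
  then have "val (u # us) \<le> val (v # vs) + val (w # ws)" using *(5) by (simp add: val_def)
  then show ?case using * v v0 by (intro exI[of _ "v # vs"] exI[of _ "w # ws"]) auto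
qed

text \<open>The functional \<open>\<psi>\<close> is \<open>|T'| g\<close>, given by \<open>x \<mapsto> sup {\<Sum> g |T u\<^sub>i| : x = \<Sum> u\<^sub>i, u\<^sub>i \<ge> 0}\<close>. The
  supremum is finite although \<open>|T|\<close> need not exist: summing over all signs, \<open>\<Sum> |T u\<^sub>i|\<close> lies
  below any bound of \<open>T[-x, x]\<close>.\<close>

lemma order_bounded_adjoint_modulus:
  fixes T :: "'a::banach_lattice \<Rightarrow>\<^sub>L 'b::banach_lattice" and g :: "'b \<Rightarrow>\<^sub>L real"
  assumes T: "order_bounded T" and g: "0 \<le> g"
  obtains \<psi> :: "'a \<Rightarrow>\<^sub>L real" where "\<And>x. blinfun_apply g (lmod (blinfun_apply T x)) \<le> blinfun_apply \<psi> (lmod x)"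
proof -
  define val where "val us = sum_list (map (\<lambda>u. blinfun_apply g (lmod (blinfun_apply T u))) us)" for us
  \<comment> \<open>With lists as decompositions, superadditivity of the supremum is
    concatenation.\<close>
  define P where "P x = {us. (\<forall>u\<in>set us. 0 \<le> u) \<and> sum_list us = x}" for x :: 'a
  define p where "p x = (SUP us\<in>P x. val us)" for x
  have bdd: "bdd_above (val ` P x)" for x
  proof -
    obtain c d where cd: "blinfun_apply T ` {- x..x} \<subseteq> {c..d}" using T unfolding order_bounded_def by metis
    show ?thesis
    proof (rule bdd_aboveI2)
      fix us assume us: "us \<in> P x"
      have "sum_list (map (\<lambda>u. lmod (blinfun_apply T u)) us) + 0 \<le> d"
      proof (rule sum_list_lmod_le)
        fix y assume "lmod y \<le> sum_list us"
        then have "y \<in> {- x..x}" using us by (simp add: P_def lmod_le_iff minus_le_iff)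
        then have "blinfun_apply T y \<in> {c..d}" using cd by blast
        then show "blinfun_apply T y + 0 \<le> d" by simp
      qed (use us in \<open>simp add: P_def\<close>)
      from dual_nonneg_mono[OF g this]
      have "blinfun_apply g (sum_list (map (\<lambda>u. lmod (blinfun_apply T u)) us)) \<le> blinfun_apply g d" by simp
      moreover have "blinfun_apply g (sum_list (map (\<lambda>u. lmod (blinfun_apply T u)) us)) = val us"
        by (induction us) (simp_all add: val_def blinfun.add_right)
      ultimately show "val us \<le> blinfun_apply g d" by simp
    qed
  qed
  have ne: "[x] \<in> P x" if "0 \<le> x" for x using that by (simp add: P_def)
  have upper: "val us \<le> p x" if "us \<in> P x" for us x unfolding p_def by (rule cSUP_upper[OF that bdd])
  have least: "p x \<le> C" if "0 \<le> x" "\<And>us. us \<in> P x \<Longrightarrow> val us \<le> C" for x C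
    unfolding p_def by (rule cSUP_least) (use that ne in auto)
  have val0: "0 \<le> val us" for us
    unfolding val_def using dual_leD[OF g lmod_nonneg] by (intro sum_list_nonneg) auto
  have nonneg: "0 \<le> p x" if "0 \<le> x" for x using order_trans[OF val0 upper[OF ne[OF that]]] .
  have add: "p (x + y) = p x + p y" if xy: "0 \<le> x" "0 \<le> y" for x y
  proof (rule antisym)
    show "p (x + y) \<le> p x + p y"
    proof (rule least)
      fix us assume "us \<in> P (x + y)"
      then obtain vs ws where "vs \<in> P x" "ws \<in> P y" "val us \<le> val vs + val ws"
        using riesz_decomposition_list[OF g, of us x y T] xy unfolding P_def val_def by blast
      then show "val us \<le> p x + p y" using upper[of vs x] upper[of ws y] by simp
    qed (use xy in simp)
    have "p x \<le> p (x + y) - p y"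
    proof (rule least[OF xy(1)])
      fix vs assume vs: "vs \<in> P x"
      have "p y \<le> p (x + y) - val vs"
      proof (rule least[OF xy(2)])
        fix ws assume "ws \<in> P y"
        with vs have "vs @ ws \<in> P (x + y)" by (auto simp: P_def)
        from upper[OF this] show "val ws \<le> p (x + y) - val vs" by (simp add: val_def)
      qed
      then show "val vs \<le> p (x + y) - p y" by simp
    qed
    then show "p x + p y \<le> p (x + y)" by simp
  qed
  have scale_le: "r * p x \<le> p (r *\<^sub>R x)" if "0 < r" "0 \<le> x" for r x
  proof -
    have "p x \<le> p (r *\<^sub>R x) / r"
    proof (rule least[OF that(2)])
      fix us assume us: "us \<in> P x"
      have "sum_list (map ((*\<^sub>R) r) us) = r *\<^sub>R sum_list us"
        by (induction us) (simp_all add: scaleR_add_right)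
      then have "map ((*\<^sub>R) r) us \<in> P (r *\<^sub>R x)"
        using us that by (auto simp: P_def scaleR_nonneg_nonneg)
      from upper[OF this] have "val (map ((*\<^sub>R) r) us) \<le> p (r *\<^sub>R x)" .
      moreover have "val (map ((*\<^sub>R) r) us) = r * val us"
        using that by (induction us) (simp_all add: val_def blinfun.scaleR_right lmod_scaleR distrib_left)
      ultimately show "val us \<le> p (r *\<^sub>R x) / r" using that by (simp add: field_simps)
    qed
    then show ?thesis using that by (simp add: field_simps)
  qed
  have scale: "p (r *\<^sub>R x) = r * p x" if "0 < r" "0 \<le> x" for r x
  proof (rule antisym)
    show "p (r *\<^sub>R x) \<le> r * p x"
      using scale_le[of "1 / r" "r *\<^sub>R x"] that by (simp add: scaleR_nonneg_nonneg field_simps)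
  qed (rule scale_le[OF that])
  obtain \<psi> :: "'a \<Rightarrow>\<^sub>L real" where \<psi>: "\<And>x. 0 \<le> x \<Longrightarrow> blinfun_apply \<psi> x = p x"
    by (rule positive_cone_extension[of p]) (use add scale nonneg in auto)
  have "blinfun_apply g (lmod (blinfun_apply T x)) \<le> blinfun_apply \<psi> (lmod x)" for x
  proof -
    let ?T = "blinfun_apply T"
    have "?T x = ?T (pprt x) + - ?T (pprt (- x))"
      by (simp only: add_uminus_conv_diff blinfun.diff_right[symmetric] pprt_minus_pprt[symmetric])
    then have "lmod (?T x) \<le> lmod (?T (pprt x)) + lmod (?T (pprt (- x)))"
      by (metis lmod_minus lmod_triangle)
    from dual_nonneg_mono[OF g this]
    have "blinfun_apply g (lmod (?T x)) \<le> val [pprt x, pprt (- x)]" by (simp add: val_def blinfun.add_right)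
    also have "\<dots> \<le> p (lmod x)" by (rule upper) (simp add: P_def lmod_eq_pprt)
    finally show ?thesis by (simp add: \<psi>)
  qed
  then show thesis by (rule that)
qed

section \<open>Almost weak Dunford--Pettis operators\<close>

lemma disjoint_seq_subseq: "disjoint_seq x \<Longrightarrow> strict_mono r \<Longrightarrow> disjoint_seq (\<lambda>n. x (r n))"
  by (simp add: disjoint_seq_def strict_mono_eq)

lemma weakly_null_subseq: "weakly_null x \<Longrightarrow> strict_mono r \<Longrightarrow> weakly_null (\<lambda>n. x (r n))"
  unfolding weakly_null_def using LIMSEQ_subseq_LIMSEQ[of "\<lambda>n. blinfun_apply f (x n)" 0 r for f]
  by (auto simp: o_def)

lemma disjoint_seq_dominated:
  assumes "disjoint_seq u" "\<And>n. lmod (v n) \<le> lmod (u n)" shows "disjoint_seq v"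
  unfolding disjoint_seq_def
proof (intro allI impI)
  fix n m :: nat assume "n \<noteq> m"
  then have "inf (lmod (u n)) (lmod (u m)) = 0" using assms(1) by (simp add: disjoint_seq_def)
  then show "inf (lmod (v n)) (lmod (v m)) = 0"
    by (rule disjoint_mono) (simp_all add: assms(2))
qed

text \<open>After passing to a subsequence, \<open>(a\<^bsub>n+1\<^esub> - 4\<^sup>n \<Sum>\<^bsub>i\<le>n\<^esub> a\<^sub>i - 2\<^sup>-\<^sup>n \<Sum>\<^sub>k 2\<^sup>-\<^sup>k a\<^sub>k)\<^sup>+\<close> is a disjoint
  sequence on which \<open>\<phi> n\<close> loses little.\<close>

lemma disjoint_subsequence:
  fixes a :: "nat \<Rightarrow> 'a::banach_lattice" and \<phi> :: "nat \<Rightarrow> 'a \<Rightarrow>\<^sub>L real"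
  assumes a: "\<And>n. 0 \<le> a n" "bounded (range a)" and \<phi>: "\<And>n. 0 \<le> \<phi> n"
    and lim: "\<And>x. 0 \<le> x \<Longrightarrow> (\<lambda>n. blinfun_apply (\<phi> n) x) \<longlonglongrightarrow> 0"
    and e: "0 < e" "\<And>n. e \<le> blinfun_apply (\<phi> n) (a n)"
  obtains r u where "strict_mono r" "disjoint_seq u" "\<And>n. 0 \<le> u n" "\<And>n. u n \<le> a (r n)"
    "\<And>n. e / 2 \<le> blinfun_apply (\<phi> (r n)) (u n)"
proof -
  have small: "\<exists>N. \<forall>n\<ge>N. blinfun_apply (\<phi> n) x < e / 4" if "0 \<le> x" for x
    using order_tendstoD(2)[OF lim[OF that], of "e / 4"] e(1) by (simp add: eventually_sequentially)
  \<comment> \<open>A state holds the last chosen index and the sum of the terms chosen so far. The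
    next index is so late that \<open>\<phi>\<close> there nearly annihilates \<open>4 ^ n\<close>
    times this sum.\<close>
  define R where "R n s s' \<longleftrightarrow> fst s < fst s' \<and> snd s' = snd s + a (fst s') \<and>
      blinfun_apply (\<phi> (fst s')) (4 ^ n *\<^sub>R snd s) < e / 4" for n and s s' :: "nat \<times> 'a"
  \<comment> \<open>The clause for \<open>n = 0\<close> records that the sum starts with its own
    index, which the step relation cannot express.\<close>
  have "\<exists>s. \<forall>n. (0 \<le> snd (s n) \<and> (n = 0 \<longrightarrow> snd (s n) = a (fst (s n)))) \<and> R n (s n) (s (Suc n))"
  proof (rule dependent_nat_choice)
    show "\<exists>s. 0 \<le> snd s \<and> ((0::nat) = 0 \<longrightarrow> snd s = a (fst s))"
      using a(1) by (intro exI[of _ "(0, a 0)"]) simp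
    fix s and n :: nat assume s: "0 \<le> snd s \<and> (n = 0 \<longrightarrow> snd s = a (fst s))"
    then have "0 \<le> 4 ^ n *\<^sub>R snd s" by (simp add: scaleR_nonneg_nonneg)
    from small[OF this] obtain N where N: "\<And>k. N \<le> k \<Longrightarrow> blinfun_apply (\<phi> k) (4 ^ n *\<^sub>R snd s) < e / 4" by blast
    define k where "k = max N (Suc (fst s))"
    have "R n s (k, snd s + a k)" using N[of k] by (simp add: R_def k_def)
    then show "\<exists>s'. (0 \<le> snd s' \<and> (Suc n = 0 \<longrightarrow> snd s' = a (fst s'))) \<and> R n s s'"
      using s a(1) by (intro exI[of _ "(k, snd s + a k)"]) simp
  qed
  then obtain s where s': "\<forall>n. (0 \<le> snd (s n) \<and> (n = 0 \<longrightarrow> snd (s n) = a (fst (s n)))) \<and> R n (s n) (s (Suc n))" ..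
  then have s: "\<And>n. 0 \<le> snd (s n)" "snd (s 0) = a (fst (s 0))" "\<And>n. R n (s n) (s (Suc n))"
    by simp_all
  define r where "r n = fst (s n)" for n
  define S where "S n = snd (s n)" for n
  have S: "0 \<le> S n" "S 0 = a (r 0)" "S (Suc n) = S n + a (r (Suc n))"
    "blinfun_apply (\<phi> (r (Suc n))) (4 ^ n *\<^sub>R S n) < e / 4" for n
    using s(1,2) s(3)[of n] by (simp_all add: r_def S_def R_def)
  have r: "strict_mono r" using s(3) by (intro strict_monoI_Suc) (simp add: r_def R_def)
  have aS: "a (r i) \<le> S n" if "i \<le> n" for i n
    using that
  proof (induction n)
    case (Suc n)
    show ?case
    proof (cases "i = Suc n")
      case False
      then have "a (r i) \<le> S n" using Suc by simp
      also have "S n \<le> S (Suc n)" using a(1) by (simp add: S(3))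
      finally show ?thesis .
    qed (simp add: S(1,3))
  qed (simp add: S(2))
  obtain M where M: "\<And>n. norm (a n) \<le> M" using a(2) by (auto simp: bounded_iff)
  define X where "X k = (1 / 2 ^ k) *\<^sub>R a (r k)" for k
  have X0: "0 \<le> X k" for k by (simp add: X_def a(1) scaleR_nonneg_nonneg)
  have sX: "summable X"
  proof (rule summable_comparison_test')
    show "summable (\<lambda>k. (1 / 2 :: real) ^ k * M)" by (intro summable_mult2 summable_geometric) simp
    show "norm (X k) \<le> (1 / 2) ^ k * M" for k
      using M[of "r k"] by (simp add: X_def power_one_over divide_right_mono)
  qed
  define Y where "Y = suminf X"
  have XY: "X k \<le> Y" for k unfolding Y_def by (rule summand_le_suminf[OF sX X0])
  have Y0: "0 \<le> Y" using order_trans[OF X0 XY] .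
  define u where "u n = pprt (a (r (Suc n)) - 4 ^ n *\<^sub>R S n - (1 / 2 ^ n) *\<^sub>R Y)" for n
  have pos: "0 \<le> 4 ^ n *\<^sub>R S n" "0 \<le> (1 / 2 ^ n) *\<^sub>R Y" for n
    using S(1) Y0 by (auto intro!: scaleR_nonneg_nonneg)
  have u0: "0 \<le> u n" for n by (simp add: u_def)
  have ule: "u n \<le> a (r (Suc n))" for n
  proof -
    have "a (r (Suc n)) - 4 ^ n *\<^sub>R S n - (1 / 2 ^ n) *\<^sub>R Y \<le> a (r (Suc n)) - 0 - 0"
      using pos[of n] by (intro diff_mono) auto
    then show ?thesis unfolding u_def pprt_def using a(1) by simp
  qed
  have dis: "inf (u n) (u m) = 0" if "n < m" for n m
  proof -
    \<comment> \<open>\<open>u n\<close> lies below the positive part of \<open>v\<close> and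
      \<open>u m\<close> below a multiple of its negative part. The first uses the summand of
      \<open>Y\<close> with index \<open>Suc m\<close>, and \<open>4 ^ m\<close> suffices since
      \<open>n + Suc m \<le> 2 * m\<close>; the second uses the term of \<open>S m\<close> with
      index \<open>Suc n\<close>.\<close>
    define v where "v = a (r (Suc n)) - (1 / 4 ^ m) *\<^sub>R a (r (Suc m))"
    have "u n \<le> pprt v" unfolding u_def
    proof (rule pprt_mono)
      have "(1 / 4 ^ m) *\<^sub>R a (r (Suc m)) \<le> (1 / 2 ^ n * (1 / 2 ^ Suc m)) *\<^sub>R a (r (Suc m))"
      proof (rule scaleR_right_mono)
        have "(2::real) ^ n * 2 ^ Suc m = 2 ^ (n + Suc m)" by (simp add: power_add)
        also have "\<dots> \<le> 2 ^ (2 * m)" using that by (intro power_increasing) auto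
        also have "\<dots> = 4 ^ m" by (simp add: power_mult)
        finally show "1 / 4 ^ m \<le> 1 / 2 ^ n * (1 / 2 ^ Suc m :: real)"
          using frac_le[of 1 1 "2 ^ n * 2 ^ Suc m" "4 ^ m :: real"] by simp
      qed (rule a(1))
      also have "\<dots> = (1 / 2 ^ n) *\<^sub>R X (Suc m)" by (simp add: X_def)
      also have "\<dots> \<le> (1 / 2 ^ n) *\<^sub>R Y" by (rule scaleR_left_mono[OF XY]) simp
      finally have "a (r (Suc n)) - 4 ^ n *\<^sub>R S n - (1 / 2 ^ n) *\<^sub>R Y \<le> a (r (Suc n)) - 0 - (1 / 4 ^ m) *\<^sub>R a (r (Suc m))"
        using pos(1)[of n] by (intro diff_mono) auto
      then show "a (r (Suc n)) - 4 ^ n *\<^sub>R S n - (1 / 2 ^ n) *\<^sub>R Y \<le> v" by (simp add: v_def)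
    qed
    moreover have "u m \<le> 4 ^ m *\<^sub>R pprt (- v)"
    proof -
      have "4 ^ m *\<^sub>R a (r (Suc n)) \<le> 4 ^ m *\<^sub>R S m"
        using that by (intro scaleR_left_mono aS) auto
      then have "a (r (Suc m)) - 4 ^ m *\<^sub>R S m - (1 / 2 ^ m) *\<^sub>R Y \<le> a (r (Suc m)) - 4 ^ m *\<^sub>R a (r (Suc n)) - 0"
        using pos(2)[of m] by (intro diff_mono) auto
      also have "\<dots> = 4 ^ m *\<^sub>R (- v)" by (simp add: v_def scaleR_diff_right)
      finally have "u m \<le> pprt (4 ^ m *\<^sub>R (- v))" unfolding u_def by (rule pprt_mono)
      also have "\<dots> = 4 ^ m *\<^sub>R pprt (- v)" unfolding pprt_def by (subst scaleR_sup) simp_all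
      finally show ?thesis .
    qed
    moreover have "inf (pprt v) (4 ^ m *\<^sub>R pprt (- v)) = 0"
      by (rule disjoint_scaleR[OF pprt_disjoint]) simp
    ultimately show ?thesis using u0[of n] u0[of m] disjoint_mono by blast
  qed
  \<comment> \<open>The two subtracted terms cost less than \<open>e / 4\<close> each. For the one
    with \<open>Y\<close> this holds only from \<open>N\<close> on, hence the shift by
    \<open>N\<close> at the end.\<close>
  obtain N where N: "\<And>n. N \<le> n \<Longrightarrow> blinfun_apply (\<phi> n) Y < e / 4" using small[OF Y0] by blast
  have big: "e / 2 \<le> blinfun_apply (\<phi> (r (Suc n))) (u n)" if "N \<le> n" for n
  proof -
    let ?\<phi> = "blinfun_apply (\<phi> (r (Suc n)))"
    have "N \<le> r (Suc n)" using strict_mono_imp_increasing[OF r, of "Suc n"] that by simp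
    then have Y: "?\<phi> Y < e / 4" by (rule N)
    have "0 \<le> ?\<phi> Y" using dual_leD[OF \<phi> Y0] by simp
    then have "?\<phi> Y / 2 ^ n \<le> ?\<phi> Y" using mult_left_mono[of "1 / 2 ^ n" 1 "?\<phi> Y"] by simp
    moreover have "?\<phi> (a (r (Suc n)) - 4 ^ n *\<^sub>R S n - (1 / 2 ^ n) *\<^sub>R Y) \<le> ?\<phi> (u n)"
      unfolding u_def by (rule dual_nonneg_mono[OF \<phi>]) (simp add: pprt_def)
    moreover have "?\<phi> (a (r (Suc n)) - 4 ^ n *\<^sub>R S n - (1 / 2 ^ n) *\<^sub>R Y)
        = ?\<phi> (a (r (Suc n))) - ?\<phi> (4 ^ n *\<^sub>R S n) - ?\<phi> Y / 2 ^ n"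
      by (simp add: blinfun.diff_right blinfun.scaleR_right)
    ultimately show ?thesis using e(2)[of "r (Suc n)"] S(4)[of n] Y by linarith
  qed
  show thesis
  proof
    show "strict_mono (\<lambda>n. r (Suc (n + N)))" using r by (simp add: strict_mono_def)
    show "disjoint_seq (\<lambda>n. u (n + N))" unfolding disjoint_seq_def
    proof (intro allI impI)
      fix n m :: nat assume "n \<noteq> m"
      then consider "n < m" | "m < n" by linarith
      then show "inf (lmod (u (n + N))) (lmod (u (m + N))) = 0"
      proof cases
        case 1
        then show ?thesis using dis[of "n + N" "m + N"] u0 by simp
      next
        case 2
        then show ?thesis using dis[of "m + N" "n + N"] u0 by (simp add: inf_commute)
      qed
    qed
    show "0 \<le> u (n + N)" "u (n + N) \<le> a (r (Suc (n + N)))" for n using u0 ule by auto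
    show "e / 2 \<le> blinfun_apply (\<phi> (r (Suc (n + N)))) (u (n + N))" for n by (rule big) simp
  qed
qed

section \<open>The equivalences\<close>

lemma sol_bounded:
  fixes A :: "'a::banach_lattice set"
  assumes "bounded A" obtains M where "\<And>x. x \<in> sol A \<Longrightarrow> norm x \<le> M"
proof -
  obtain M where M: "\<And>a. a \<in> A \<Longrightarrow> norm a \<le> M" using assms by (auto simp: bounded_iff)
  have "norm x \<le> M" if "x \<in> sol A" for x
  proof -
    from that obtain a where "a \<in> A" "lmod x \<le> lmod a" by (auto simp: sol_def)
    then show ?thesis using M[of a] lmod_le_norm[of x a] by simp
  qed
  then show thesis by (rule that)
qed

lemma sol_mono: "x \<in> sol A \<Longrightarrow> lmod y \<le> lmod x \<Longrightarrow> y \<in> sol A"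
  unfolding sol_def by (auto intro: order_trans)

lemma subset_sol: "A \<subseteq> sol A"
  by (auto simp: sol_def)

lemma almost_weak_DP_imp_almost_DP_set_sol:
  fixes T :: "'e::banach_lattice \<Rightarrow>\<^sub>L 'f::banach_lattice"
  assumes T: "order_bounded T" "almost_weak_DP T" and A: "rel_weakly_compact A"
  shows "almost_DP_set (blinfun_apply T ` sol A)"
proof -
  obtain M where M: "\<And>x. x \<in> sol A \<Longrightarrow> norm x \<le> M"
    using sol_bounded[OF rel_weakly_compact_bounded[OF A]] by blast
  have "bounded (blinfun_apply T ` sol A)"
  proof (rule boundedI)
    fix y assume "y \<in> blinfun_apply T ` sol A"
    then obtain x where x: "x \<in> sol A" "y = blinfun_apply T x" by blast
    show "norm y \<le> norm T * M"
      using norm_blinfun[of T x] mult_left_mono[OF M[OF x(1)], of "norm T"] x(2) by simp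
  qed
  moreover have "eventually (\<lambda>n. \<forall>y\<in>blinfun_apply T ` sol A. \<bar>blinfun_apply (f n) y\<bar> \<le> e) sequentially"
    if f: "dual_disjoint_seq f" "weakly_null f" and e: "0 < e" for f :: "nat \<Rightarrow> 'f \<Rightarrow>\<^sub>L real" and e :: real
  proof (rule ccontr)
    assume "\<not> ?thesis"
    from not_eventually_sequentiallyD[OF this] obtain s :: "nat \<Rightarrow> nat" where
      s': "strict_mono s \<and> (\<forall>n. \<not> (\<forall>y\<in>blinfun_apply T ` sol A. \<bar>blinfun_apply (f (s n)) y\<bar> \<le> e))" ..
    then have s: "strict_mono s" by simp
    from s' have "\<forall>n. \<exists>x\<in>sol A. e < \<bar>blinfun_apply (f (s n)) (blinfun_apply T x)\<bar>" by (simp add: not_le)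
    then obtain x where x: "\<And>n. x n \<in> sol A" "\<And>n. e < \<bar>blinfun_apply (f (s n)) (blinfun_apply T (x n))\<bar>" by metis
    define g where "g n = adjoint_op T (f (s n))" for n
    have g: "blinfun_apply (g n) y = blinfun_apply (f (s n)) (blinfun_apply T y)" for n y
      by (simp add: g_def adjoint_op_def)
    have lim: "(\<lambda>n. blinfun_apply (lmod (g n)) a) \<longlonglongrightarrow> 0" if "0 \<le> a" for a
    proof -
      obtain c d where cd: "blinfun_apply T ` {- a..a} \<subseteq> {c..d}" using T(1) unfolding order_bounded_def by metis
      \<comment> \<open>\<open>T\<close> maps the interval from \<open>- a\<close> to
        \<open>a\<close> into that from \<open>- z\<close> to \<open>z\<close>, so the modulus of
        \<open>g n\<close> at \<open>a\<close> is at most that of \<open>f (s n)\<close> at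
        \<open>z\<close>. The latter tends to 0 because moduli of disjoint weakly null sequences are
        weakly null.\<close>
      define z where "z = sup d (- c)"
      have z: "lmod (blinfun_apply T y) \<le> z" if "lmod y \<le> a" for y
      proof -
        have "y \<in> {- a..a}" using that by (simp add: lmod_le_iff minus_le_iff)
        then have "blinfun_apply T y \<in> {c..d}" using cd by blast
        then show ?thesis unfolding lmod_le_iff z_def by (simp add: le_supI1 le_supI2)
      qed
      have "weakly_null (\<lambda>n. lmod (f n))" using f by (intro weakly_null_lmod) (simp_all add: dual_disjoint_seq_iff)
      then have "weakly_null (\<lambda>n. lmod (f (s n)))" using s by (rule weakly_null_subseq)
      then have "(\<lambda>n. blinfun_apply (eval_at z) (lmod (f (s n)))) \<longlonglongrightarrow> 0" unfolding weakly_null_def by blast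
      then have fz: "(\<lambda>n. blinfun_apply (lmod (f (s n))) z) \<longlonglongrightarrow> 0" by (simp add: eval_at_apply)
      have le: "blinfun_apply (lmod (g n)) a \<le> blinfun_apply (lmod (f (s n))) z" for n
        unfolding lmod_dual_apply[OF that]
      proof (rule dmod_least[OF that])
        fix y assume "lmod y \<le> a"
        show "\<bar>blinfun_apply (g n) y\<bar> \<le> blinfun_apply (lmod (f (s n))) z"
          unfolding g
          by (rule order_trans[OF abs_apply_le dual_nonneg_mono[OF lmod_nonneg z[OF \<open>lmod y \<le> a\<close>]]])
      qed
      have ge: "0 \<le> blinfun_apply (lmod (g n)) a" for n using dual_leD[OF lmod_nonneg that, of "g n"] by simp
      show ?thesis
        by (rule tendsto_sandwich[OF _ _ tendsto_const fz]) (use le ge in \<open>auto intro: always_eventually\<close>)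
    qed
    have "bounded (range (\<lambda>n. lmod (x n)))" using M[OF x(1)] by (intro boundedI[of _ M]) auto
    moreover have "e \<le> blinfun_apply (lmod (g n)) (lmod (x n))" for n
      using abs_apply_le[of "g n" "x n"] x(2)[of n] by (simp add: g)
    ultimately obtain r u where r: "strict_mono r" and u: "disjoint_seq u" "\<And>n. 0 \<le> u n"
      "\<And>n. u n \<le> lmod (x (r n))" "\<And>n. e / 2 \<le> blinfun_apply (lmod (g (r n))) (u n)"
      using disjoint_subsequence[of "\<lambda>n. lmod (x n)" "\<lambda>n. lmod (g n)" e] lim e by auto
    \<comment> \<open>The supremum defining the modulus of \<open>g (r n)\<close> at
      \<open>u n\<close> is nearly attained at some \<open>v\<close>. Domination by
      \<open>u n\<close> keeps the sequence disjoint and inside \<open>sol A\<close>, so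
      \<open>T\<close> can be tested on it.\<close>
    have "\<exists>v. lmod v \<le> u n \<and> e / 4 < \<bar>blinfun_apply (g (r n)) v\<bar>" for n
    proof -
      have "e / 4 < dmod (g (r n)) (u n)" using u(4)[of n] e by (simp add: lmod_dual_apply[OF u(2)])
      then show ?thesis by (rule dmod_approx[OF u(2)]) blast
    qed
    then obtain v where v: "\<And>n. lmod (v n) \<le> u n" "\<And>n. e / 4 < \<bar>blinfun_apply (g (r n)) (v n)\<bar>" by metis
    have dv: "disjoint_seq v" by (rule disjoint_seq_dominated[OF u(1)]) (simp add: u(2) v(1))
    have "v n \<in> sol A" for n by (rule sol_mono[OF x(1)[of "r n"]]) (rule order_trans[OF v(1) u(3)])
    then have "weakly_null v" by (rule disjoint_seq_sol_weakly_null[OF A dv])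
    moreover have "dual_disjoint_seq (\<lambda>n. f (s (r n)))"
      using disjoint_seq_subseq[OF disjoint_seq_subseq[OF _ s] r] f(1) by (simp add: dual_disjoint_seq_iff)
    moreover have "weakly_null (\<lambda>n. f (s (r n)))"
      by (rule weakly_null_subseq[OF weakly_null_subseq[OF f(2) s] r])
    ultimately have "(\<lambda>n. blinfun_apply (f (s (r n))) (blinfun_apply T (v n))) \<longlonglongrightarrow> 0"
      using T(2) dv unfolding almost_weak_DP_def by blast
    from LIMSEQ_D[OF this, of "e / 4"] e obtain n where "\<bar>blinfun_apply (g (r n)) (v n)\<bar> < e / 4"
      by (auto simp: g)
    then show False using v(2)[of n] by simp
  qed
  ultimately show ?thesis unfolding almost_DP_set_def by blast
qed

lemma almost_weak_DP_imp_almost_L_set_sol: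
  fixes T :: "'e::banach_lattice \<Rightarrow>\<^sub>L 'f::banach_lattice"
  assumes T: "order_bounded T" "almost_weak_DP T" and B: "rel_weakly_compact B"
  shows "almost_L_set (adjoint_op T ` dual_sol B)"
proof -
  obtain M where M: "\<And>g. g \<in> sol B \<Longrightarrow> norm g \<le> M"
    using sol_bounded[OF rel_weakly_compact_bounded[OF B]] by blast
  have ad: "blinfun_apply (adjoint_op T g) x = blinfun_apply g (blinfun_apply T x)" for g x
    by (simp add: adjoint_op_def)
  have "bounded (adjoint_op T ` sol B)"
  proof (rule boundedI)
    fix h assume "h \<in> adjoint_op T ` sol B"
    then obtain g where g: "g \<in> sol B" "h = adjoint_op T g" by blast
    show "norm h \<le> M * norm T"
      using norm_blinfun_compose[of g T] mult_right_mono[OF M[OF g(1)], of "norm T"] g(2)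
      by (simp add: adjoint_op_def)
  qed
  moreover have "eventually (\<lambda>n. \<forall>g\<in>adjoint_op T ` sol B. \<bar>blinfun_apply g (x n)\<bar> \<le> e) sequentially"
    if x: "disjoint_seq x" "weakly_null x" and e: "0 < e" for x :: "nat \<Rightarrow> 'e" and e :: real
  proof (rule ccontr)
    assume "\<not> ?thesis"
    from not_eventually_sequentiallyD[OF this] obtain s :: "nat \<Rightarrow> nat" where
      s': "strict_mono s \<and> (\<forall>n. \<not> (\<forall>g\<in>adjoint_op T ` sol B. \<bar>blinfun_apply g (x (s n))\<bar> \<le> e))" ..
    then have s: "strict_mono s" by simp
    from s' have "\<forall>n. \<exists>g\<in>sol B. e < \<bar>blinfun_apply g (blinfun_apply T (x (s n)))\<bar>" by (simp add: not_le ad)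
    then obtain g where g: "\<And>n. g n \<in> sol B" "\<And>n. e < \<bar>blinfun_apply (g n) (blinfun_apply T (x (s n)))\<bar>" by metis
    \<comment> \<open>Here the modulus falls on the vector \<open>T x\<close>, and the gliding
      sequence consists of the functionals \<open>g n\<close>; so
      \<open>disjoint_subsequence\<close> is used in the dual, with evaluations as positive
      functionals.\<close>
    define \<phi> where "\<phi> n = eval_at (lmod (blinfun_apply T (x (s n))))" for n
    have \<phi>: "blinfun_apply (\<phi> n) h = blinfun_apply h (lmod (blinfun_apply T (x (s n))))" for n h
      by (simp add: \<phi>_def eval_at_apply)
    have \<phi>0: "0 \<le> \<phi> n" for n
      unfolding dual_le_iff[of 0 "\<phi> n"] \<phi> using dual_leD[OF _ lmod_nonneg] by force
    have lim: "(\<lambda>n. blinfun_apply (\<phi> n) h) \<longlonglongrightarrow> 0" if h: "0 \<le> h" for h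
    proof -
      \<comment> \<open>The vectors \<open>lmod (T x)\<close> have no evident bound by an operator
        at \<open>lmod x\<close>. After applying \<open>h\<close> they have one, and weak nullness
        of the moduli of \<open>x\<close> applies to it.\<close>
      obtain \<psi> :: "'e \<Rightarrow>\<^sub>L real" where \<psi>: "\<And>x. blinfun_apply h (lmod (blinfun_apply T x)) \<le> blinfun_apply \<psi> (lmod x)"
        using order_bounded_adjoint_modulus[OF T(1) h] by blast
      have "weakly_null (\<lambda>n. lmod (x (s n)))" by (rule weakly_null_subseq[OF weakly_null_lmod[OF x] s])
      then have *: "(\<lambda>n. blinfun_apply \<psi> (lmod (x (s n)))) \<longlonglongrightarrow> 0" by (simp add: weakly_null_def)
      have "0 \<le> blinfun_apply (\<phi> n) h" for n using dual_leD[OF \<phi>0 h] by simp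
      then show ?thesis
        by (intro tendsto_sandwich[OF _ _ tendsto_const *]) (use \<psi> in \<open>auto simp: \<phi> intro: always_eventually\<close>)
    qed
    have "bounded (range (\<lambda>n. lmod (g n)))" using M[OF g(1)] by (intro boundedI[of _ M]) auto
    moreover have "e \<le> blinfun_apply (\<phi> n) (lmod (g n))" for n
      using abs_apply_le[of "g n" "blinfun_apply T (x (s n))"] g(2)[of n] by (simp add: \<phi>)
    ultimately obtain r u where r: "strict_mono r" and u: "disjoint_seq u" "\<And>n. 0 \<le> u n"
      "\<And>n. u n \<le> lmod (g (r n))" "\<And>n. e / 2 \<le> blinfun_apply (\<phi> (r n)) (u n)"
      using disjoint_subsequence[of "\<lambda>n. lmod (g n)" \<phi> e] lim \<phi>0 e by auto
    \<comment> \<open>The modulus around \<open>T x\<close> is removed on the side of the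
      functional: some \<open>v\<close> between 0 and \<open>u n\<close> retains half of the value
      at \<open>T x\<close> itself.\<close>
    have "\<exists>v. 0 \<le> v \<and> v \<le> u n \<and> e / 4 \<le> \<bar>blinfun_apply v (blinfun_apply T (x (s (r n))))\<bar>" for n
    proof -
      obtain v where "0 \<le> v" "v \<le> u n"
        "blinfun_apply (u n) (lmod (blinfun_apply T (x (s (r n))))) \<le> 2 * \<bar>blinfun_apply v (blinfun_apply T (x (s (r n))))\<bar>"
        using dual_attains_half_lmod[OF u(2)] by blast
      then show ?thesis using u(4)[of n] by (intro exI[of _ v]) (simp add: \<phi>)
    qed
    then obtain v where v: "\<And>n. 0 \<le> v n" "\<And>n. v n \<le> u n"
      "\<And>n. e / 4 \<le> \<bar>blinfun_apply (v n) (blinfun_apply T (x (s (r n))))\<bar>" by metis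
    have dv: "disjoint_seq v" by (rule disjoint_seq_dominated[OF u(1)]) (simp add: u(2) v(1,2))
    have "v n \<in> sol B" for n
      by (rule sol_mono[OF g(1)[of "r n"]]) (use order_trans[OF v(2) u(3), of n] v(1) in simp)
    then have "weakly_null v" by (rule disjoint_seq_sol_weakly_null[OF B dv])
    moreover have "disjoint_seq (\<lambda>n. x (s (r n)))"
      by (rule disjoint_seq_subseq[OF disjoint_seq_subseq[OF x(1) s] r])
    moreover have "weakly_null (\<lambda>n. x (s (r n)))"
      by (rule weakly_null_subseq[OF weakly_null_subseq[OF x(2) s] r])
    ultimately have "(\<lambda>n. blinfun_apply (v n) (blinfun_apply T (x (s (r n))))) \<longlonglongrightarrow> 0"
      using T(2) dv unfolding almost_weak_DP_def dual_disjoint_seq_iff by blast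
    from LIMSEQ_D[OF this, of "e / 4"] e obtain n where "\<bar>blinfun_apply (v n) (blinfun_apply T (x (s (r n))))\<bar> < e / 4"
      by auto
    then show False using v(3)[of n] by simp
  qed
  ultimately show ?thesis unfolding almost_L_set_def dual_sol_eq_sol by blast
qed

lemma almost_DP_set_subset:
  assumes "almost_DP_set A" "B \<subseteq> A" shows "almost_DP_set B"
  unfolding almost_DP_set_def
proof (intro conjI allI impI)
  show "bounded B" using assms by (auto simp: almost_DP_set_def intro: bounded_subset)
  fix f :: "nat \<Rightarrow> 'a \<Rightarrow>\<^sub>L real" and e :: real assume "dual_disjoint_seq f \<and> weakly_null f" "0 < e"
  with assms(1) have "eventually (\<lambda>n. \<forall>y\<in>A. \<bar>blinfun_apply (f n) y\<bar> \<le> e) sequentially"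
    by (simp add: almost_DP_set_def)
  then show "eventually (\<lambda>n. \<forall>y\<in>B. \<bar>blinfun_apply (f n) y\<bar> \<le> e) sequentially"
    by (rule eventually_mono) (use assms(2) in blast)
qed

lemma almost_L_set_subset:
  assumes "almost_L_set A" "B \<subseteq> A" shows "almost_L_set B"
  unfolding almost_L_set_def
proof (intro conjI allI impI)
  show "bounded B" using assms by (auto simp: almost_L_set_def intro: bounded_subset)
  fix x :: "nat \<Rightarrow> 'a" and e :: real assume "disjoint_seq x \<and> weakly_null x" "0 < e"
  with assms(1) have "eventually (\<lambda>n. \<forall>y\<in>A. \<bar>blinfun_apply y (x n)\<bar> \<le> e) sequentially"
    by (simp add: almost_L_set_def)
  then show "eventually (\<lambda>n. \<forall>y\<in>B. \<bar>blinfun_apply y (x n)\<bar> \<le> e) sequentially"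
    by (rule eventually_mono) (use assms(2) in blast)
qed

text \<open>The range of a weakly null sequence is relatively weakly compact, and uniform
  convergence on its image includes the diagonal values.\<close>

lemma almost_DP_images_imp_almost_weak_DP:
  fixes T :: "'a::banach_lattice \<Rightarrow>\<^sub>L 'b::banach_lattice"
  assumes "\<And>A. rel_weakly_compact A \<Longrightarrow> almost_DP_set (blinfun_apply T ` A)"
  shows "almost_weak_DP T"
  unfolding almost_weak_DP_def
proof (intro allI impI)
  fix x :: "nat \<Rightarrow> 'a" and f :: "nat \<Rightarrow> 'b \<Rightarrow>\<^sub>L real"
  assume H: "disjoint_seq x \<and> weakly_null x \<and> dual_disjoint_seq f \<and> weakly_null f"
  then have A: "almost_DP_set (blinfun_apply T ` range x)"
    by (intro assms weakly_null_rel_weakly_compact) blast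
  show "(\<lambda>n. blinfun_apply (f n) (blinfun_apply T (x n))) \<longlonglongrightarrow> 0"
  proof (rule LIMSEQ_I)
    fix e :: real assume e: "0 < e"
    have "eventually (\<lambda>n. \<forall>y\<in>blinfun_apply T ` range x. \<bar>blinfun_apply (f n) y\<bar> \<le> e / 2) sequentially"
      using A H half_gt_zero[OF e] unfolding almost_DP_set_def by blast
    then obtain N where N: "\<And>n. N \<le> n \<Longrightarrow> \<bar>blinfun_apply (f n) (blinfun_apply T (x n))\<bar> \<le> e / 2"
      by (auto simp: eventually_sequentially)
    have "norm (blinfun_apply (f n) (blinfun_apply T (x n)) - 0) < e" if "N \<le> n" for n
      using N[OF that] e by simp
    then show "\<exists>N. \<forall>n\<ge>N. norm (blinfun_apply (f n) (blinfun_apply T (x n)) - 0) < e" by blast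
  qed
qed

text \<open>The same diagonal argument, with the range of the functionals as the relatively weakly
  compact set.\<close>

lemma almost_L_images_imp_almost_weak_DP:
  fixes T :: "'a::banach_lattice \<Rightarrow>\<^sub>L 'b::banach_lattice"
  assumes "\<And>B. rel_weakly_compact B \<Longrightarrow> almost_L_set (adjoint_op T ` B)"
  shows "almost_weak_DP T"
  unfolding almost_weak_DP_def
proof (intro allI impI)
  fix x :: "nat \<Rightarrow> 'a" and f :: "nat \<Rightarrow> 'b \<Rightarrow>\<^sub>L real"
  assume H: "disjoint_seq x \<and> weakly_null x \<and> dual_disjoint_seq f \<and> weakly_null f"
  then have B: "almost_L_set (adjoint_op T ` range f)"
    by (intro assms weakly_null_rel_weakly_compact) blast
  show "(\<lambda>n. blinfun_apply (f n) (blinfun_apply T (x n))) \<longlonglongrightarrow> 0"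
  proof (rule LIMSEQ_I)
    fix e :: real assume e: "0 < e"
    have "eventually (\<lambda>n. \<forall>g\<in>adjoint_op T ` range f. \<bar>blinfun_apply g (x n)\<bar> \<le> e / 2) sequentially"
      using B H half_gt_zero[OF e] unfolding almost_L_set_def by blast
    then obtain N where N: "\<And>n. N \<le> n \<Longrightarrow> \<bar>blinfun_apply (f n) (blinfun_apply T (x n))\<bar> \<le> e / 2"
      by (auto simp: eventually_sequentially adjoint_op_def)
    have "norm (blinfun_apply (f n) (blinfun_apply T (x n)) - 0) < e" if "N \<le> n" for n
      using N[OF that] e by simp
    then show "\<exists>N. \<forall>n\<ge>N. norm (blinfun_apply (f n) (blinfun_apply T (x n)) - 0) < e" by blast
  qed
qed

theorem theorem2p3:
  fixes T :: "'e::banach_lattice \<Rightarrow>\<^sub>L 'f::banach_lattice"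
  assumes "order_bounded T"
  shows "(almost_weak_DP T \<longleftrightarrow>
           (\<forall>A :: 'e set. rel_weakly_compact A \<longrightarrow> almost_DP_set (T ` sol A)))
       \<and> (almost_weak_DP T \<longleftrightarrow>
           (\<forall>A :: 'e set. rel_weakly_compact A \<longrightarrow> almost_DP_set (T ` A)))
       \<and> (almost_weak_DP T \<longleftrightarrow>
           (\<forall>B :: ('f \<Rightarrow>\<^sub>L real) set. rel_weakly_compact B \<longrightarrow>
              almost_L_set (adjoint_op T ` dual_sol B)))
       \<and> (almost_weak_DP T \<longleftrightarrow>
           (\<forall>B :: ('f \<Rightarrow>\<^sub>L real) set. rel_weakly_compact B \<longrightarrow>
              almost_L_set (adjoint_op T ` B)))"
  (is "(?wDP \<longleftrightarrow> ?DP_sol) \<and> (?wDP \<longleftrightarrow> ?DP) \<and> (?wDP \<longleftrightarrow> ?L_sol) \<and> (?wDP \<longleftrightarrow> ?L)")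
proof -
  have "?DP_sol" if "?wDP"
    using almost_weak_DP_imp_almost_DP_set_sol[OF assms that] by blast
  moreover have "?DP" if "?DP_sol"
    using that almost_DP_set_subset[OF _ image_mono[OF subset_sol]] by blast
  moreover have "?wDP" if "?DP"
    by (rule almost_DP_images_imp_almost_weak_DP) (use that in blast)
  moreover have "?L_sol" if "?wDP"
    using almost_weak_DP_imp_almost_L_set_sol[OF assms that] by blast
  moreover have "?L" if "?L_sol"
    using that almost_L_set_subset[OF _ image_mono[OF subset_sol]] unfolding dual_sol_eq_sol by blast
  moreover have "?wDP" if "?L"
    by (rule almost_L_images_imp_almost_weak_DP) (use that in blast)
  ultimately show ?thesis by argo
qed

end
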